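(* Let $m\in\{0,1,2,\dots\}$ be fixed and let $\{W_i\}_{i\ge1}$ be an $m$-dependent sequence (not necessarily stationary). Suppose that for some $r\ge2$ $$\lim_{M\to\infty}\sup_n\sup_{i,j\le n}E\big[|\varphi(W_i,W_j)|^r\,1\{|\varphi(W_i,W_j)|>M\}\big]=0 .\qquad(\ast)$$ Then, as $n\to\infty$: (a) $\displaystyle U_{n,2}=\frac2n\sum_{i=1}^n\bar\varphi^{(1)}_{n,m,2,i}(W_i)+O_p\Big(\frac{m+1}{n}\Big)$; (b) $\displaystyle U_{n,2}=O_p\Big(\sqrt{\frac{m+1}{n}}\Big)=o_p(1)$. (c) If, in addition, $(\ast)$ holds for some $r>2$ and $\sigma_{n,m,2}^2\ge\lambda>0$ for a constant $\lambda$ not depending on $n$, then $\sigma_{n,m,2}^{-1}\sqrt n\,U_{n,2}\xrightarrow{d}\mathcal N(0,1)$.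
   Context: A sequence $\{W_i\}_{i\ge1}$ of random elements of a standard Borel space is $m$-dependent if for every $s\ge1$ the $\sigma$-fields $\sigma(W_1,\dots,W_s)$ and $\sigma(W_{s+m+j}:j\ge1)$ are independent. The kernel $\varphi$ is real-valued, measurable, symmetric in its two arguments, and centred on lag-generic pairs: $E[\varphi(W_i,W_j)]=0$ whenever $|i-j|>m$. No centring is imposed on pairs with $|i-j|\le m$. $U_{n,2}=\frac1{n(n-1)}\sum_{i=1}^n\sum_{j\ne i}\varphi(W_i,W_j)$, the indices ranging over $[n]=\{1,\dots,n\}$. $\varphi_j^{(1)}(W_i)=E[\varphi(W_i,W_j)\mid W_i]$; $Q_i=\#\{j\in[n]\setminus\{i\}:|i-j|>m\}$ (positive for all large $n$); $\bar\varphi^{(1)}_{n,m,2,i}(W_i)=Q_i^{-1}\sum_{j\in[n],\,|i-j|>m}\varphi_j^{(1)}(W_i)$. $\sigma_{n,m,2}\ge0$ is given by $\sigma_{n,m,2}^2=\frac4n\operatorname{Var}\big[\sum_{i=1}^n\bar\varphi^{(1)}_{n,m,2,i}(W_i)\big]$. *)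

theory Defs
  imports "HOL-Probability.Probability"
begin

definition standard_borel :: "'b measure \<Rightarrow> bool" where
  "standard_borel S \<longleftrightarrow>
     (\<exists>T. completely_metrizable_space T \<and> second_countable T \<and>
          space S = topspace T \<and> sets S = sigma_sets (topspace T) {U. openin T U})"

definition generated_sigma ::
  "'a measure \<Rightarrow> 'b measure \<Rightarrow> (nat \<Rightarrow> 'a \<Rightarrow> 'b) \<Rightarrow> nat set \<Rightarrow> 'a measure" where
  "generated_sigma M S W I =
     sigma (space M) (\<Union>i\<in>I. sets (vimage_algebra (space M) (W i) S))"

text \<open>Sequences are indexed from 1; the value of \<open>W 0\<close> is never used.\<close>

definition m_dependent ::
  "'a measure \<Rightarrow> 'b measure \<Rightarrow> nat \<Rightarrow> (nat \<Rightarrow> 'a \<Rightarrow> 'b) \<Rightarrow> bool" where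
  "m_dependent M S m W \<longleftrightarrow>
     (\<forall>i\<ge>1. W i \<in> measurable M S) \<and>
     (\<forall>s\<ge>1. prob_space.indep_set M
        (sets (generated_sigma M S W {1..s}))
        (sets (generated_sigma M S W {s + m + j | j. j \<ge> 1})))"

text \<open>
  The moments are extended nonnegative integrals, so that a non-integrable kernel gives an
  infinite moment and not the default value 0 of the Bochner integral.
\<close>

definition kernel_unif_integrable ::
  "'a measure \<Rightarrow> (nat \<Rightarrow> 'a \<Rightarrow> 'b) \<Rightarrow> ('b \<Rightarrow> 'b \<Rightarrow> real) \<Rightarrow> real \<Rightarrow> bool" where
  "kernel_unif_integrable M W \<phi> r \<longleftrightarrow>
     ((\<lambda>K::real. SUP n::nat. SUP i\<in>{1..n}. SUP j\<in>{1..n}.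
         \<integral>\<^sup>+ \<omega>. ennreal (\<bar>\<phi> (W i \<omega>) (W j \<omega>)\<bar> powr r
                  * indicator {K<..} \<bar>\<phi> (W i \<omega>) (W j \<omega>)\<bar>) \<partial>M)
       \<longlongrightarrow> 0) at_top"

definition lag_centred ::
  "'a measure \<Rightarrow> nat \<Rightarrow> (nat \<Rightarrow> 'a \<Rightarrow> 'b) \<Rightarrow> ('b \<Rightarrow> 'b \<Rightarrow> real) \<Rightarrow> bool" where
  "lag_centred M m W \<phi> \<longleftrightarrow>
     (\<forall>i\<ge>1. \<forall>j\<ge>1. \<bar>int i - int j\<bar> > int m \<longrightarrow>
        prob_space.expectation M (\<lambda>\<omega>. \<phi> (W i \<omega>) (W j \<omega>)) = 0)"

definition U_stat ::
  "(nat \<Rightarrow> 'a \<Rightarrow> 'b) \<Rightarrow> ('b \<Rightarrow> 'b \<Rightarrow> real) \<Rightarrow> nat \<Rightarrow> 'a \<Rightarrow> real" where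
  "U_stat W \<phi> n \<omega> =
     1 / (real n * (real n - 1)) *
       (\<Sum>i\<in>{1..n}. \<Sum>j\<in>{1..n} - {i}. \<phi> (W i \<omega>) (W j \<omega>))"

text \<open>
  \<open>proj1 M S W \<phi> j i\<close> is a version of \<open>E[\<phi>(W i, W j) | W i]\<close>, as a random variable on \<open>M\<close>.
\<close>

definition proj1 ::
  "'a measure \<Rightarrow> 'b measure \<Rightarrow> (nat \<Rightarrow> 'a \<Rightarrow> 'b) \<Rightarrow> ('b \<Rightarrow> 'b \<Rightarrow> real) \<Rightarrow>
    nat \<Rightarrow> nat \<Rightarrow> 'a \<Rightarrow> real" where
  "proj1 M S W \<phi> j i =
     real_cond_exp M (generated_sigma M S W {i}) (\<lambda>\<omega>. \<phi> (W i \<omega>) (W j \<omega>))"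

definition lag_count :: "nat \<Rightarrow> nat \<Rightarrow> nat \<Rightarrow> nat" where
  "lag_count n m i = card {j \<in> {1..n} - {i}. \<bar>int i - int j\<bar> > int m}"

definition avg_proj1 ::
  "'a measure \<Rightarrow> 'b measure \<Rightarrow> (nat \<Rightarrow> 'a \<Rightarrow> 'b) \<Rightarrow> ('b \<Rightarrow> 'b \<Rightarrow> real) \<Rightarrow>
    nat \<Rightarrow> nat \<Rightarrow> nat \<Rightarrow> 'a \<Rightarrow> real" where
  "avg_proj1 M S W \<phi> n m i \<omega> =
     (\<Sum>j\<in>{j \<in> {1..n}. \<bar>int i - int j\<bar> > int m}. proj1 M S W \<phi> j i \<omega>) / real (lag_count n m i)"

definition proj_sd ::
  "'a measure \<Rightarrow> 'b measure \<Rightarrow> (nat \<Rightarrow> 'a \<Rightarrow> 'b) \<Rightarrow> ('b \<Rightarrow> 'b \<Rightarrow> real) \<Rightarrow>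
    nat \<Rightarrow> nat \<Rightarrow> real" where
  "proj_sd M S W \<phi> n m =
     sqrt (4 / real n * prob_space.variance M (\<lambda>\<omega>. \<Sum>i\<in>{1..n}. avg_proj1 M S W \<phi> n m i \<omega>))"

definition big_O_prob :: "'a measure \<Rightarrow> (nat \<Rightarrow> 'a \<Rightarrow> real) \<Rightarrow> (nat \<Rightarrow> real) \<Rightarrow> bool" where
  "big_O_prob M X a \<longleftrightarrow>
     (\<forall>n. X n \<in> borel_measurable M) \<and>
     (\<forall>\<epsilon>>0. \<exists>C>0. \<forall>\<^sub>F n in sequentially.
        measure M {\<omega> \<in> space M. \<bar>X n \<omega>\<bar> > C * a n} \<le> \<epsilon>)"

definition small_o_prob :: "'a measure \<Rightarrow> (nat \<Rightarrow> 'a \<Rightarrow> real) \<Rightarrow> (nat \<Rightarrow> real) \<Rightarrow> bool" where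
  "small_o_prob M X a \<longleftrightarrow>
     (\<forall>n. X n \<in> borel_measurable M) \<and>
     (\<forall>\<epsilon>>0. (\<lambda>n. measure M {\<omega> \<in> space M. \<bar>X n \<omega>\<bar> > \<epsilon> * a n}) \<longlonglongrightarrow> 0)"

end

theory Submission
  imports Defs
begin

text \<open>
  Over pairs with lag greater than \<open>m\<close>, subtract the two projections from the kernel. By independence
  of an index that is isolated from the other three, the products of two such remainders are centred
  unless both indices of one pair are near the other pair; hence only \<open>O(n\<^sup>2)\<close> of the \<open>n\<^sup>4\<close> products
  contribute to the second moment of the degenerate sum, which is therefore negligible in \<open>L\<^sup>1\<close>. The
  \<open>O(n)\<close> near pairs and the discrepancy between \<open>Q_i\<close> and \<open>n - 1\<close> are of the same order \<open>1 / n\<close>.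

  Asymptotic normality of the projection is obtained by the method of Stein and Tikhomirov. For
  \<open>Z = X_1 + \<dots> + X_n\<close> and \<open>\<eta>_i\<close> the sum of the \<open>X_j\<close> with \<open>|i - j| \<le> m\<close>, the variable \<open>X_i\<close> is independent
  of \<open>Z - \<eta>_i\<close>, so \<open>E[X_i e^{iuZ}] = E[X_i (1 - e^{-iu\<eta>_i}) e^{iuZ}] \<approx> iu E[X_i \<eta>_i e^{iuZ}]\<close>. As
  \<open>T = \<Sum> X_i \<eta>_i\<close> concentrates around its mean \<open>s\<^sup>2 = Var Z\<close>, the characteristic function of \<open>Z\<close>
  nearly solves \<open>\<psi>' = - s\<^sup>2 u \<psi>\<close>.
\<close>

section \<open>Independence and conditional expectations of an m-dependent sequence\<close>

text \<open>The definition of m-dependence separates a past from a future, whereas the isolated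
  index of a product of two remainders may lie between the other three. So independence of W_k from
  indices on both sides of k has to come first (\<open>indep_isolated\<close>). Conditional
  expectations are fixed only up to null sets; a Fubini argument (\<open>decouple\<close>)
  identifies them with integrals over the law of W_k, also in the presence of a factor that depends
  on many other W_b. With moments of order q slightly above 2, the products X_i X_j have moments of
  order q/2 only, so T need not have a variance. Its concentration is therefore shown after clipping
  each product at a level K. The clipped sum deviates by order K sqrt n and the excess by order n
  K^(1 - q/2); after division by s^2, which is at least of order n, both vanish for K = n^(1/4). The
  averaged projections change with n, so the limit theorem concerns a triangular array. All
  estimates are made for a fixed row with explicit constants, and n tends to infinity only at the
  end.\<close>

locale m_dependent_sequence = prob_space M
  for M :: "'a measure" +
  fixes S :: "'b measure" and W :: "nat \<Rightarrow> 'a \<Rightarrow> 'b" and m :: nat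
  assumes m_dep: "m_dependent M S m W"
begin

abbreviation gs :: "nat set \<Rightarrow> 'a measure" where
  "gs \<equiv> generated_sigma M S W"

definition near :: "nat \<Rightarrow> nat \<Rightarrow> bool" where
  "near i j \<longleftrightarrow> \<bar>int i - int j\<bar> \<le> int m"

lemma near_sym: "near i j \<Longrightarrow> near j i"
  by (auto simp: near_def)

lemma near_refl [simp]: "near i i"
  by (simp add: near_def)

lemma W_measurable: "1 \<le> i \<Longrightarrow> W i \<in> measurable M S"
  using m_dep by (auto simp: m_dependent_def)

lemma gs_generators_subset: "(\<Union>i\<in>I. sets (vimage_algebra (space M) (W i) S)) \<subseteq> Pow (space M)"
  using sets.sets_into_space by fastforce

lemma space_gs [simp]: "space (gs I) = space M"
  using gs_generators_subset by (simp add: generated_sigma_def space_measure_of_conv)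

lemma sets_gs:
  "sets (gs I) = sigma_sets (space M) (\<Union>i\<in>I. sets (vimage_algebra (space M) (W i) S))"
  using gs_generators_subset by (simp add: generated_sigma_def)

lemma vimage_algebra_sets_M: "1 \<le> i \<Longrightarrow> sets (vimage_algebra (space M) (W i) S) \<subseteq> sets M"
  using W_measurable[of i] by (auto simp: sets_vimage_algebra2 measurable_space measurable_sets)

lemma sets_gs_mono: "I \<subseteq> J \<Longrightarrow> sets (gs I) \<subseteq> sets (gs J)"
  unfolding sets_gs by (intro sigma_sets_mono') auto

lemma subalgebra_gs: 
  assumes "\<And>i. i \<in> I \<Longrightarrow> 1 \<le> i"
  shows "subalgebra M (gs I)"
proof -
  have "(\<Union>i\<in>I. sets (vimage_algebra (space M) (W i) S)) \<subseteq> sets M"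
    using vimage_algebra_sets_M assms by auto
  then have "sets (gs I) \<subseteq> sets M"
    unfolding sets_gs by (rule sets.sigma_sets_subset)
  then show ?thesis by (simp add: subalgebra_def)
qed

lemma measurable_gs_mono:
  assumes "I \<subseteq> J" "f \<in> measurable (gs I) T"
  shows "f \<in> measurable (gs J) T"
  using measurable_from_subalg[of "gs J" "gs I" f T] assms sets_gs_mono[of I J] by (simp add: subalgebra_def)

lemma measurable_gs_M: "(\<And>i. i \<in> I \<Longrightarrow> 1 \<le> i) \<Longrightarrow> f \<in> measurable (gs I) T \<Longrightarrow> f \<in> measurable M T"
  using measurable_from_subalg subalgebra_gs by blast

lemma W_measurable_gs: 
  assumes "i \<in> I" "1 \<le> i" 
  shows "W i \<in> measurable (gs I) S"
proof (rule measurableI)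
  show "W i x \<in> space S" if "x \<in> space (gs I)" for x
    using that W_measurable[OF assms(2)] by (auto simp: measurable_space)
  show "W i -` A \<inter> space (gs I) \<in> sets (gs I)" if "A \<in> sets S" for A
    using that assms(1) by (auto simp: sets_gs intro!: sigma_sets.Basic bexI[of _ i] in_vimage_algebra)
qed

text \<open>With s the maximum of I, both index sets sit inside the initial segment and the tail of
  \<open>m_dependent\<close>, and independence passes to smaller sigma-fields. Finiteness of I
  supplies the maximum; J may be an infinite tail.\<close>

lemma indep_past_future:
  assumes I: "\<And>i. i \<in> I \<Longrightarrow> 1 \<le> i" and J: "\<And>j. j \<in> J \<Longrightarrow> 1 \<le> j"
    and gap: "\<And>i j. i \<in> I \<Longrightarrow> j \<in> J \<Longrightarrow> i + m < j" and "finite I"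
  shows "indep_set (sets (gs I)) (sets (gs J))"
\<comment> \<open>The empty set has no maximum; its sigma-field is trivial and hence independent of
  every other.\<close>
proof (cases "I = {}")
  case True
  have "sets (gs I) = {{}, space M}"
    unfolding sets_gs True by (simp add: sigma_sets_empty_eq)
  moreover have "space M \<inter> b = b" if "b \<in> sets (gs J)" for b
    using sets.sets_into_space[OF that] by auto
  ultimately show ?thesis
    using subalgebra_gs[OF J] by (intro indep_setI) (auto simp: subalgebra_def prob_space)
next
  case False
  define s where "s = Max I"
  have s: "s \<in> I" "1 \<le> s" "I \<subseteq> {1..s}"
    using False \<open>finite I\<close> I by (auto simp: s_def)
  have J': "J \<subseteq> {s + m + j | j. j \<ge> 1}"
  proof
    fix j assume "j \<in> J"
    then have "j = s + m + (j - s - m)" "j - s - m \<ge> 1"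
      using gap[OF s(1)] by force+
    then show "j \<in> {s + m + j | j. j \<ge> 1}" by blast
  qed
  have "indep_set (sets (gs {1..s})) (sets (gs {s + m + j | j. j \<ge> 1}))"
    using m_dep s(2) by (auto simp: m_dependent_def)
  then show ?thesis
    using sets_gs_mono[OF s(3)] sets_gs_mono[OF J'] unfolding indep_sets2_eq by blast
qed

lemma indep_set_commute: "indep_set A B \<Longrightarrow> indep_set B A"
  unfolding indep_sets2_eq by (metis Int_commute mult.commute)

text \<open>The intersections of a past event with a future event form a \<open>\<pi>\<close>-system, on which independence
  from \<open>W k\<close> follows from applying \<open>m\<close>-dependence once before and once after \<open>k\<close>.\<close>

lemma indep_isolated:
  assumes k: "1 \<le> k" and B: "\<And>b. b \<in> B \<Longrightarrow> 1 \<le> b" and iso: "\<And>b. b \<in> B \<Longrightarrow> \<not> near k b"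
  shows "indep_set (sets (gs {k})) (sets (gs B))"
proof -
  \<comment> \<open>For k at most m + 1 the truncated subtraction makes P empty, as it should: no
    index then precedes k by more than m.\<close>
  define P F where "P = {1..<k - m}" and "F = {k + m<..}"
  define E where "E = {p \<inter> f | p f. p \<in> sets (gs P) \<and> f \<in> sets (gs F)}"
  have iPF: "indep_set (sets (gs P)) (sets (gs (insert k F)))"
    by (rule indep_past_future) (use k in \<open>auto simp: P_def F_def\<close>)
  have ikF: "indep_set (sets (gs {k})) (sets (gs F))"
    by (rule indep_past_future) (use k in \<open>auto simp: P_def F_def\<close>)
  have sk: "sets (gs {k}) \<subseteq> sets (gs (insert k F))" "sets (gs F) \<subseteq> sets (gs (insert k F))"
    by (auto intro!: sets_gs_mono)
  have M: "sets (gs P) \<subseteq> events" "sets (gs {k}) \<subseteq> events" "sets (gs F) \<subseteq> events"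
    using iPF ikF by (auto simp: indep_sets2_eq)
  have "indep_set (sets (gs {k})) E"
  proof (rule indep_setI)
    show "sets (gs {k}) \<subseteq> events" by fact
    show "E \<subseteq> events" using M by (auto simp: E_def)
    fix a b assume a: "a \<in> sets (gs {k})" and "b \<in> E"
    then obtain p f where b: "b = p \<inter> f" "p \<in> sets (gs P)" "f \<in> sets (gs F)"
      by (auto simp: E_def)
    \<comment> \<open>The event is regrouped as p against a and f together: the future block of
      \<open>iPF\<close> contains k itself.\<close>
    have af: "a \<inter> f \<in> sets (gs (insert k F))" using a b sk by auto
    have "prob (a \<inter> b) = prob (p \<inter> (a \<inter> f))" unfolding b by (simp add: Int_ac)
    also have "\<dots> = prob p * (prob a * prob f)"
      using indep_setD[OF iPF b(2) af] indep_setD[OF ikF a b(3)] by simp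
    \<comment> \<open>The same independence again, now with f alone, puts the two sides of b back
      together.\<close>
    also have "prob p * prob f = prob b"
      using indep_setD[OF iPF b(2), of f] b sk by auto
    then have "prob p * (prob a * prob f) = prob a * prob b" by simp
    finally show "prob (a \<inter> b) = prob a * prob b" .
  qed
  moreover have "Int_stable (sets (gs {k}))" by (rule sets.Int_stable)
  moreover have "Int_stable E"
  proof (rule Int_stableI)
    fix a b assume "a \<in> E" "b \<in> E"
    then obtain p f p' f' where *: "a = p \<inter> f" "p \<in> sets (gs P)" "f \<in> sets (gs F)"
        "b = p' \<inter> f'" "p' \<in> sets (gs P)" "f' \<in> sets (gs F)"
      by (auto simp: E_def)
    then have "a \<inter> b = (p \<inter> p') \<inter> (f \<inter> f')" by auto
    then show "a \<inter> b \<in> E" unfolding E_def using * by blast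
  qed
  ultimately have "indep_set (sigma_sets (space M) (sets (gs {k}))) (sigma_sets (space M) E)"
    by (rule indep_set_sigma_sets)
  moreover have "sets (gs {k}) \<subseteq> sigma_sets (space M) (sets (gs {k}))" 
    by auto
  \<comment> \<open>A generator lives on one side of k only and lies in \<open>E\<close> with the
    whole space as the event of the other side.\<close>
  moreover have "sets (gs B) \<subseteq> sigma_sets (space M) E"
  proof -
    have top: "space M \<in> sets (gs I)" for I
      using sets.top[of "gs I"] by simp
    have "sets (vimage_algebra (space M) (W b) S) \<subseteq> E" if b: "b \<in> B" for b
    proof -
      have V: "sets (vimage_algebra (space M) (W b) S) \<subseteq> sets (gs I)" if "b \<in> I" for I
        unfolding sets_gs using that by auto
      have "b \<in> P \<or> b \<in> F"
        using iso[OF b] B[OF b] by (auto simp: near_def P_def F_def)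
      then show ?thesis
      proof
        assume "b \<in> P"
        show ?thesis
        proof
          fix x assume "x \<in> sets (vimage_algebra (space M) (W b) S)"
          then have "x \<in> sets (gs P)" "x = x \<inter> space M"
            using V[OF \<open>b \<in> P\<close>] sets.sets_into_space[of x "gs P"] by auto
          then show "x \<in> E" unfolding E_def using top by blast
        qed
      next
        assume "b \<in> F"
        show ?thesis
        proof
          fix x assume "x \<in> sets (vimage_algebra (space M) (W b) S)"
          then have "x \<in> sets (gs F)" "x = space M \<inter> x"
            using V[OF \<open>b \<in> F\<close>] sets.sets_into_space[of x "gs F"] by auto
          then show "x \<in> E" unfolding E_def using top by blast
        qed
      qed
    qed
    then show ?thesis
      unfolding sets_gs by (intro sigma_sets_mono') auto
  qed
  ultimately show ?thesis
    unfolding indep_sets2_eq by blast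
qed

section \<open>Independent blocks, Fubini and projections\<close>

lemma indep_var_gs:
  assumes I: "\<And>i. i \<in> I \<Longrightarrow> 1 \<le> i" and J: "\<And>j. j \<in> J \<Longrightarrow> 1 \<le> j"
    and ind: "indep_set (sets (gs I)) (sets (gs J))"
    and X: "X \<in> measurable (gs I) N" and Y: "Y \<in> measurable (gs J) N'"
  shows "indep_var N X N' Y"
proof -
  have "sigma_sets (space M) {X -` A \<inter> space M |A. A \<in> sets N} \<subseteq> sets (gs I)"
    using measurable_sets[OF X] by (intro sigma_sets_le_sets_iff[of "gs I", simplified, THEN iffD2]) auto
  moreover have "sigma_sets (space M) {Y -` A \<inter> space M |A. A \<in> sets N'} \<subseteq> sets (gs J)"
    using measurable_sets[OF Y] by (intro sigma_sets_le_sets_iff[of "gs J", simplified, THEN iffD2]) auto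
  ultimately show ?thesis
    using ind measurable_gs_M[OF I X] measurable_gs_M[OF J Y]
    unfolding indep_var_eq indep_sets2_eq by blast
qed

text \<open>The form of independence that Fubini consumes. The two variables may have different
  value types; in \<open>decouple\<close> one of them is a pair of a real number and a point of
  S.\<close>

lemma distr_pair_gs:
  assumes I: "\<And>i. i \<in> I \<Longrightarrow> 1 \<le> i" and J: "\<And>j. j \<in> J \<Longrightarrow> 1 \<le> j"
    and ind: "indep_set (sets (gs I)) (sets (gs J))"
    and X: "X \<in> measurable (gs I) N" and Y: "Y \<in> measurable (gs J) N'"
  shows "distr M N X \<Otimes>\<^sub>M distr M N' Y = distr M (N \<Otimes>\<^sub>M N') (\<lambda>\<omega>. (X \<omega>, Y \<omega>))"
proof (rule pair_measure_eqI)
  have [measurable]: "X \<in> measurable M N" "Y \<in> measurable M N'"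
    using measurable_gs_M[OF I X] measurable_gs_M[OF J Y] by auto
  show "sigma_finite_measure (distr M N X)" "sigma_finite_measure (distr M N' Y)"
    by (auto intro!: prob_space_imp_sigma_finite prob_space_distr)
  show "sets (distr M N X \<Otimes>\<^sub>M distr M N' Y) = sets (distr M (N \<Otimes>\<^sub>M N') (\<lambda>\<omega>. (X \<omega>, Y \<omega>)))"
    by simp
  fix A B assume "A \<in> sets (distr M N X)" "B \<in> sets (distr M N' Y)"
  then have A [measurable]: "A \<in> sets N" and B [measurable]: "B \<in> sets N'" by auto
  have "prob ((X -` A \<inter> space M) \<inter> (Y -` B \<inter> space M)) = prob (X -` A \<inter> space M) * prob (Y -` B \<inter> space M)"
    using measurable_sets[OF X A] measurable_sets[OF Y B] by (intro indep_setD[OF ind]) auto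
  moreover have "(\<lambda>\<omega>. (X \<omega>, Y \<omega>)) -` (A \<times> B) \<inter> space M = (X -` A \<inter> space M) \<inter> (Y -` B \<inter> space M)"
    by auto
  ultimately show "emeasure (distr M N X) A * emeasure (distr M N' Y) B =
      emeasure (distr M (N \<Otimes>\<^sub>M N') (\<lambda>\<omega>. (X \<omega>, Y \<omega>))) (A \<times> B)"
    by (simp add: emeasure_distr emeasure_eq_measure ennreal_mult)
qed

text \<open>W_k is independent of all that c and W_l depend on, so integrating it out first turns
  the kernel into its projection. This exceeds the defining property of the conditional expectation
  given W_l, since c may depend on every W_b with b in B.\<close>

lemma decouple:
  assumes phi [measurable]: "(\<lambda>(x, y). \<phi> x y) \<in> borel_measurable (S \<Otimes>\<^sub>M S)"
    and k: "1 \<le> k" and B: "\<And>b. b \<in> B \<Longrightarrow> 1 \<le> b" and iso: "\<And>b. b \<in> B \<Longrightarrow> \<not> near k b"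
    and l: "l \<in> B" and c: "c \<in> borel_measurable (gs B)"
    and int: "integrable M (\<lambda>\<omega>. \<phi> (W l \<omega>) (W k \<omega>))"
    and cint: "integrable M (\<lambda>\<omega>. c \<omega> * \<phi> (W l \<omega>) (W k \<omega>))"
  shows "integrable M (\<lambda>\<omega>. c \<omega> * proj1 M S W \<phi> k l \<omega>)"
    and "expectation (\<lambda>\<omega>. c \<omega> * \<phi> (W l \<omega>) (W k \<omega>)) = expectation (\<lambda>\<omega>. c \<omega> * proj1 M S W \<phi> k l \<omega>)"
proof -
  have l1: "1 \<le> l" using B l by auto
  have [measurable]: "W k \<in> measurable M S" "W l \<in> measurable M S" using W_measurable k l1 by auto
  define \<mu> where "\<mu> = distr M S (W k)"
  interpret mu: prob_space \<mu> unfolding \<mu>_def by (rule prob_space_distr) simp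
  have sets_mu [measurable_cong]: "sets \<mu> = sets S" by (simp add: \<mu>_def)
  \<comment> \<open>By independence, freezing W_l at y reduces conditioning to integration over the
    law of W_k.\<close>
  define g where "g y = (\<integral>x. \<phi> y x \<partial>\<mu>)" for y
  have g[measurable]: "g \<in> borel_measurable S" unfolding g_def by measurable
  \<comment> \<open>The multiplier is kept generic because three are needed: the constant 1 for
    integrability of g(W_l), indicators of sets in \<open>gs {l}\<close> to recognise the
    conditional expectation, and finally the given c.\<close>
  have main: "integrable M (\<lambda>\<omega>. c \<omega> * g (W l \<omega>)) \<and>
      expectation (\<lambda>\<omega>. c \<omega> * \<phi> (W l \<omega>) (W k \<omega>)) = expectation (\<lambda>\<omega>. c \<omega> * g (W l \<omega>))"
    if c: "c \<in> borel_measurable (gs B)" and cint: "integrable M (\<lambda>\<omega>. c \<omega> * \<phi> (W l \<omega>) (W k \<omega>))" for c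
  proof -
    \<comment> \<open>Packing c and W_l together leaves just two independent blocks, this pair and
      W_k.\<close>
    define Y :: "'a \<Rightarrow> real \<times> 'b" where "Y \<omega> = (c \<omega>, W l \<omega>)" for \<omega>
    have Ygs: "Y \<in> measurable (gs B) (borel \<Otimes>\<^sub>M S)"
      unfolding Y_def using c W_measurable_gs[OF l l1] by measurable
    have YM [measurable]: "Y \<in> measurable M (borel \<Otimes>\<^sub>M S)" 
      using measurable_gs_M[OF B Ygs] by auto
    let ?N =  "borel \<Otimes>\<^sub>M S :: (real \<times> 'b) measure"
    have eq: "distr M ?N Y \<Otimes>\<^sub>M \<mu> = distr M (?N \<Otimes>\<^sub>M S) (\<lambda>\<omega>. (Y \<omega>, W k \<omega>))"
      unfolding \<mu>_def
    proof (rule distr_pair_gs[of B "{k}"])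
      show "indep_set (sets (gs B)) (sets (gs {k}))"
        using indep_isolated[OF k B iso] by (rule indep_set_commute)
    qed (use k B Ygs W_measurable_gs[of k "{k}"] in auto)
    interpret nu: prob_space "distr M (?N) Y" by (rule prob_space_distr) simp
    interpret pair_sigma_finite "distr M (?N) Y" \<mu> ..
    define h where "h = (\<lambda>(y, x). fst y * \<phi> (snd y) x)"
    have h [measurable]: "h \<in> borel_measurable ((?N) \<Otimes>\<^sub>M S)"
      unfolding h_def by measurable
    have hY: "h (Y \<omega>, W k \<omega>) = c \<omega> * \<phi> (W l \<omega>) (W k \<omega>)" for \<omega> by (simp add: h_def Y_def)
    have hint: "integrable (distr M (?N) Y \<Otimes>\<^sub>M \<mu>) h"
      unfolding eq by (subst integrable_distr_eq) (auto simp: hY cint)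
    have inner: "(\<integral>x. h (y, x) \<partial>\<mu>) = fst y * g (snd y)" for y
      by (simp add: h_def g_def)
    have "integrable (distr M (?N) Y) (\<lambda>y. fst y * g (snd y))"
      using integrable_fst'[OF hint] by (simp add: inner)
    then have "integrable M (\<lambda>\<omega>. c \<omega> * g (W l \<omega>))"
      by (subst (asm) integrable_distr_eq) (auto simp: Y_def)
    moreover have "expectation (\<lambda>\<omega>. c \<omega> * \<phi> (W l \<omega>) (W k \<omega>)) = integral\<^sup>L (distr M (?N) Y \<Otimes>\<^sub>M \<mu>) h"
      unfolding eq by (subst integral_distr) (auto simp: hY)
    moreover have "\<dots> = (\<integral>y. fst y * g (snd y) \<partial>distr M (?N) Y)"
      using integral_fst'[OF hint] by (simp add: inner)
    moreover have "\<dots> = expectation (\<lambda>\<omega>. c \<omega> * g (W l \<omega>))"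
      by (subst integral_distr) (auto simp: Y_def)
    ultimately show ?thesis by simp
  qed
  have sub: "subalgebra M (gs {l})" using l1 by (intro subalgebra_gs) auto
  interpret F: finite_measure_subalgebra M "gs {l}" by unfold_locales (rule sub)
  \<comment> \<open>\<open>proj1\<close> is some version of the conditional expectation, so it
    agrees with g(W_l) almost everywhere at best.\<close>
  have AE: "AE \<omega> in M. proj1 M S W \<phi> k l \<omega> = g (W l \<omega>)"
    unfolding proj1_def
  proof (rule F.real_cond_exp_charact)
    show "integrable M (\<lambda>\<omega>. \<phi> (W l \<omega>) (W k \<omega>))" by fact
    show "integrable M (\<lambda>\<omega>. g (W l \<omega>))" using main[of "\<lambda>_. 1"] int by simp
    show "(\<lambda>\<omega>. g (W l \<omega>)) \<in> borel_measurable (gs {l})"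
      using W_measurable_gs[of l "{l}"] l1 by measurable
    fix A assume A: "A \<in> sets (gs {l})"
    then have A': "A \<in> sets (gs B)" "A \<in> sets M" 
      using sets_gs_mono[of "{l}" B] l sub by (auto simp: subalgebra_def)
    show "(\<integral>x\<in>A. \<phi> (W l x) (W k x) \<partial>M) = (\<integral>x\<in>A. g (W l x) \<partial>M)"
      using main[of "indicator A"] A' integrable_mult_indicator[OF A'(2) int]
      by (auto simp: set_lebesgue_integral_def)
  qed
  have p [measurable]: "proj1 M S W \<phi> k l \<in> borel_measurable M" unfolding proj1_def by simp
  have [measurable]: "c \<in> borel_measurable M" using measurable_gs_M[OF B c] by auto
  have AE2: "AE \<omega> in M. c \<omega> * proj1 M S W \<phi> k l \<omega> = c \<omega> * g (W l \<omega>)" using AE by auto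
  show "integrable M (\<lambda>\<omega>. c \<omega> * proj1 M S W \<phi> k l \<omega>)"
    using main[OF c cint] AE2 by (subst integrable_cong_AE) auto
  show "expectation (\<lambda>\<omega>. c \<omega> * \<phi> (W l \<omega>) (W k \<omega>)) = expectation (\<lambda>\<omega>. c \<omega> * proj1 M S W \<phi> k l \<omega>)"
    using main[OF c cint] AE2 by (subst (2) integral_cong_AE) auto
qed

end

section \<open>Moments\<close>

text \<open>Convexity at positive arguments is extended to the endpoint 0, where it amounts to u^p
  being at most u on (0, 1), and then to negative arguments by the triangle inequality and
  monotonicity.\<close>

lemma convex_on_abs_powr:
  fixes p :: real
  assumes p: "1 \<le> p"
  shows "convex_on UNIV (\<lambda>x::real. \<bar>x\<bar> powr p)"
proof (rule convex_onI)
  fix t x y :: real assume t: "0 < t" "t < 1"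
  have *: "((1 - t) * a + t * b) powr p \<le> (1 - t) * a powr p + t * b powr p" if "0 \<le> a" "0 \<le> b" for a b
  proof -
    have le: "u powr p \<le> u" if "0 < u" "u < 1" for u :: real
      using that p powr_mono'[of 1 p u] by simp
    consider "a = 0" | "b = 0" | "0 < a" "0 < b" using \<open>0 \<le> a\<close> \<open>0 \<le> b\<close> by force
    then show ?thesis
    proof cases
      case 1
      then show ?thesis using le[of t] t p by (auto simp: powr_mult intro!: mult_right_mono)
    next
      case 2
      then show ?thesis using le[of "1 - t"] t p by (auto simp: powr_mult intro!: mult_right_mono)
    next
      case 3
      then show ?thesis
        using convex_onD[OF powr_convex[OF p], of t a b] t by simp
    qed
  qed
  have "\<bar>(1 - t) *\<^sub>R x + t *\<^sub>R y\<bar> powr p \<le> ((1 - t) * \<bar>x\<bar> + t * \<bar>y\<bar>) powr p"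
    using t p abs_triangle_ineq[of "(1 - t) * x" "t * y"] by (intro powr_mono2) (auto simp: abs_mult)
  also have "\<dots> \<le> (1 - t) * \<bar>x\<bar> powr p + t * \<bar>y\<bar> powr p"
    by (rule *) auto
  finally show "\<bar>(1 - t) *\<^sub>R x + t *\<^sub>R y\<bar> powr p \<le> (1 - t) * \<bar>x\<bar> powr p + t * \<bar>y\<bar> powr p" .
qed simp

text \<open>Jensen's inequality for uniform weights. The empty index set is included, both sides
  being 0 by division by zero; this covers small n, for which Q_i may vanish.\<close>

lemma abs_mean_powr_le:
  fixes a :: "'i \<Rightarrow> real"
  assumes "1 \<le> p" "finite A"
  shows "\<bar>(\<Sum>i\<in>A. a i) / card A\<bar> powr p \<le> (\<Sum>i\<in>A. \<bar>a i\<bar> powr p) / card A"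
proof (cases "A = {}")
  case False
  then have "0 < card A" using assms(2) by (simp add: card_gt_0_iff)
  then have "\<bar>\<Sum>i\<in>A. (1 / card A) *\<^sub>R a i\<bar> powr p \<le> (\<Sum>i\<in>A. (1 / card A) * \<bar>a i\<bar> powr p)"
    by (intro convex_on_sum[OF assms(2) False convex_on_abs_powr[OF assms(1)]]) auto
  then show ?thesis by (simp add: sum_divide_distrib)
qed simp

section \<open>Second moments and sums with few correlated terms\<close>

context prob_space
begin

text \<open>Measurability is part of the notion because integrability of the square does not imply
  it.\<close>

definition square_integrable :: "('a \<Rightarrow> real) \<Rightarrow> bool" where
  "square_integrable X \<longleftrightarrow> X \<in> borel_measurable M \<and> integrable M (\<lambda>\<omega>. (X \<omega>)\<^sup>2)"

lemma square_integrable_measurable: "square_integrable X \<Longrightarrow> X \<in> borel_measurable M"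
  by (simp add: square_integrable_def)

lemma square_integrable_integrable: "square_integrable X \<Longrightarrow> integrable M X"
  unfolding square_integrable_def by (auto intro: square_integrable_imp_integrable)

lemma integrable_mult_square_integrable:
  assumes "square_integrable X" "square_integrable Y"
  shows "integrable M (\<lambda>\<omega>. X \<omega> * Y \<omega>)"
proof (rule Bochner_Integration.integrable_bound)
  show "integrable M (\<lambda>\<omega>. (X \<omega>)\<^sup>2 + (Y \<omega>)\<^sup>2)"
    using assms by (auto simp: square_integrable_def)
  show "(\<lambda>\<omega>. X \<omega> * Y \<omega>) \<in> borel_measurable M"
    using assms by (auto simp: square_integrable_def)
  have "\<bar>x * y\<bar> \<le> x\<^sup>2 + y\<^sup>2" for x y :: real
  proof -
    have "2 * (\<bar>x\<bar> * \<bar>y\<bar>) \<le> x\<^sup>2 + y\<^sup>2" using sum_squares_bound[of "\<bar>x\<bar>" "\<bar>y\<bar>"] by simp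
    moreover have "0 \<le> \<bar>x\<bar> * \<bar>y\<bar>" by simp
    ultimately show ?thesis unfolding abs_mult by linarith
  qed
  then show "AE \<omega> in M. norm (X \<omega> * Y \<omega>) \<le> norm ((X \<omega>)\<^sup>2 + (Y \<omega>)\<^sup>2)"
    by (auto intro!: AE_I2 intro: order_trans)
qed

lemma square_integrable_add:
  assumes "square_integrable X" "square_integrable Y"
  shows "square_integrable (\<lambda>\<omega>. X \<omega> + Y \<omega>)"
  using assms integrable_mult_square_integrable[OF assms]
  by (auto simp: square_integrable_def power2_sum mult.assoc)

lemma square_integrable_cmult:
  "square_integrable X \<Longrightarrow> square_integrable (\<lambda>\<omega>. c * X \<omega>)"
  by (auto simp: square_integrable_def power_mult_distrib)

lemma square_integrable_diff:
  "square_integrable X \<Longrightarrow> square_integrable Y \<Longrightarrow> square_integrable (\<lambda>\<omega>. X \<omega> - Y \<omega>)"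
  using square_integrable_add[of X "\<lambda>\<omega>. (-1) * Y \<omega>"] square_integrable_cmult[of Y "-1"] by simp

lemma square_integrable_sum:
  "(\<And>i. i \<in> A \<Longrightarrow> square_integrable (X i)) \<Longrightarrow> square_integrable (\<lambda>\<omega>. \<Sum>i\<in>A. X i \<omega>)"
  by (induction A rule: infinite_finite_induct)
     (auto intro!: square_integrable_add, simp_all add: square_integrable_def)

text \<open>Cauchy-Schwarz against the constant 1, read off from the nonnegativity of the variance
  of the absolute value.\<close>

lemma expectation_abs_le_sqrt:
  assumes "square_integrable X" "expectation (\<lambda>\<omega>. (X \<omega>)\<^sup>2) \<le> B"
  shows "expectation (\<lambda>\<omega>. \<bar>X \<omega>\<bar>) \<le> sqrt B"
proof (rule real_le_rsqrt)
  have "integrable M (\<lambda>\<omega>. \<bar>X \<omega>\<bar>)" using square_integrable_integrable[OF assms(1)] by simp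
  then have "0 \<le> expectation (\<lambda>\<omega>. (\<bar>X \<omega>\<bar>)\<^sup>2) - (expectation (\<lambda>\<omega>. \<bar>X \<omega>\<bar>))\<^sup>2"
    using assms(1) variance_positive[of "\<lambda>\<omega>. \<bar>X \<omega>\<bar>"]
    by (subst (asm) variance_eq) (auto simp: square_integrable_def)
  then show "(expectation (\<lambda>\<omega>. \<bar>X \<omega>\<bar>))\<^sup>2 \<le> B" using assms(2) by simp
qed

lemma expectation_mult_le:
  assumes X: "square_integrable X" "expectation (\<lambda>\<omega>. (X \<omega>)\<^sup>2) \<le> B"
    and Y: "square_integrable Y" "expectation (\<lambda>\<omega>. (Y \<omega>)\<^sup>2) \<le> B"
  shows "expectation (\<lambda>\<omega>. X \<omega> * Y \<omega>) \<le> B"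
proof -
  have "expectation (\<lambda>\<omega>. X \<omega> * Y \<omega>) \<le> expectation (\<lambda>\<omega>. ((X \<omega>)\<^sup>2 + (Y \<omega>)\<^sup>2) / 2)"
  proof (rule integral_mono)
    show "X \<omega> * Y \<omega> \<le> ((X \<omega>)\<^sup>2 + (Y \<omega>)\<^sup>2) / 2" for \<omega>
      using sum_squares_bound[of "X \<omega>" "Y \<omega>"] by simp
  qed (use X Y integrable_mult_square_integrable in \<open>auto simp: square_integrable_def\<close>)
  also have "\<dots> = (expectation (\<lambda>\<omega>. (X \<omega>)\<^sup>2) + expectation (\<lambda>\<omega>. (Y \<omega>)\<^sup>2)) / 2"
    using X Y by (simp add: square_integrable_def)
  finally show ?thesis using X Y by simp
qed

text \<open>The counting device behind every second-moment bound below: R a collects the partners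
  that may correlate with a, and each surviving product costs at most B. It serves the degenerate
  sum, the sum of projections and the clipped part of T.\<close>

lemma expectation_square_sum_le:
  assumes fin: "finite A" and B: "0 \<le> B"
    and X: "\<And>a. a \<in> A \<Longrightarrow> square_integrable (X a)" "\<And>a. a \<in> A \<Longrightarrow> expectation (\<lambda>\<omega>. (X a \<omega>)\<^sup>2) \<le> B"
    and orth: "\<And>a b. a \<in> A \<Longrightarrow> b \<in> A \<Longrightarrow> b \<notin> R a \<Longrightarrow> expectation (\<lambda>\<omega>. X a \<omega> * X b \<omega>) = 0"
    and R: "\<And>a. a \<in> A \<Longrightarrow> card (A \<inter> R a) \<le> r"
  shows "expectation (\<lambda>\<omega>. (\<Sum>a\<in>A. X a \<omega>)\<^sup>2) \<le> real (card A) * real r * B"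
proof -
  have int: "integrable M (\<lambda>\<omega>. X a \<omega> * X b \<omega>)" if "a \<in> A" "b \<in> A" for a b
    using that X(1) by (intro integrable_mult_square_integrable) auto
  have "expectation (\<lambda>\<omega>. (\<Sum>a\<in>A. X a \<omega>)\<^sup>2) = (\<Sum>a\<in>A. \<Sum>b\<in>A. expectation (\<lambda>\<omega>. X a \<omega> * X b \<omega>))"
    using int by (simp add: power2_eq_square sum_product)
  also have "\<dots> \<le> (\<Sum>a\<in>A. real r * B)"
  proof (rule sum_mono)
    fix a assume a: "a \<in> A"
    have "(\<Sum>b\<in>A. expectation (\<lambda>\<omega>. X a \<omega> * X b \<omega>)) = (\<Sum>b\<in>A \<inter> R a. expectation (\<lambda>\<omega>. X a \<omega> * X b \<omega>))"
      using fin orth[OF a] by (intro sum.mono_neutral_right) auto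
    also have "\<dots> \<le> real (card (A \<inter> R a)) * B"
      using a X by (intro sum_bounded_above expectation_mult_le) auto
    also have "\<dots> \<le> real r * B"
      using R[OF a] B by (intro mult_right_mono) auto
    finally show "(\<Sum>b\<in>A. expectation (\<lambda>\<omega>. X a \<omega> * X b \<omega>)) \<le> real r * B" .
  qed
  finally show ?thesis by simp
qed

text \<open>The pointwise bound of |x|^q' by |x|^q + 1 replaces Lyapunov's inequality; it is the
  origin of every later bound of the form B + 1.\<close>

lemma powr_moment_mono:
  fixes q q' B :: real
  assumes X [measurable]: "X \<in> borel_measurable M" and q: "0 \<le> q'" "q' \<le> q"
    and int: "integrable M (\<lambda>\<omega>. \<bar>X \<omega>\<bar> powr q)" and B: "expectation (\<lambda>\<omega>. \<bar>X \<omega>\<bar> powr q) \<le> B"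
  shows "integrable M (\<lambda>\<omega>. \<bar>X \<omega>\<bar> powr q')" "expectation (\<lambda>\<omega>. \<bar>X \<omega>\<bar> powr q') \<le> B + 1"
proof -
  have le: "\<bar>x\<bar> powr q' \<le> \<bar>x\<bar> powr q + 1" for x :: real
  proof (cases "\<bar>x\<bar> \<le> 1")
    case True
    then have "\<bar>x\<bar> powr q' \<le> 1" using powr_mono2[OF q(1) _ True] by simp
    then show ?thesis by (meson add_increasing powr_ge_zero)
  next
    case False
    then have "\<bar>x\<bar> powr q' \<le> \<bar>x\<bar> powr q" by (intro powr_mono q) auto
    then show ?thesis by simp
  qed
  show *: "integrable M (\<lambda>\<omega>. \<bar>X \<omega>\<bar> powr q')"
    by (rule Bochner_Integration.integrable_bound[of _ "\<lambda>\<omega>. \<bar>X \<omega>\<bar> powr q + 1"]) (use int le in auto)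
  have "expectation (\<lambda>\<omega>. \<bar>X \<omega>\<bar> powr q') \<le> expectation (\<lambda>\<omega>. \<bar>X \<omega>\<bar> powr q + 1)"
    using int * le by (intro integral_mono) auto
  then show "expectation (\<lambda>\<omega>. \<bar>X \<omega>\<bar> powr q') \<le> B + 1" using int B by (simp add: prob_space)
qed

lemma cond_exp_powr_moment:
  assumes F: "subalgebra M F" and p: "1 \<le> p"
    and X: "integrable M X" "integrable M (\<lambda>\<omega>. \<bar>X \<omega>\<bar> powr p)"
  shows "integrable M (\<lambda>\<omega>. \<bar>real_cond_exp M F X \<omega>\<bar> powr p)"
    and "expectation (\<lambda>\<omega>. \<bar>real_cond_exp M F X \<omega>\<bar> powr p) \<le> expectation (\<lambda>\<omega>. \<bar>X \<omega>\<bar> powr p)"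
proof -
  interpret F: finite_measure_subalgebra M F by unfold_locales (rule F)
  have ae: "AE \<omega> in M. \<bar>real_cond_exp M F X \<omega>\<bar> powr p \<le> real_cond_exp M F (\<lambda>\<omega>. \<bar>X \<omega>\<bar> powr p) \<omega>"
    using F.real_cond_exp_jensens_inequality(2)[OF X(1) _ _ X(2) convex_on_abs_powr[OF p]] by simp
  note int = F.real_cond_exp_int[OF X(2)]
  show *: "integrable M (\<lambda>\<omega>. \<bar>real_cond_exp M F X \<omega>\<bar> powr p)"
    by (rule Bochner_Integration.integrable_bound[OF int(1)]) (use ae in auto)
  show "expectation (\<lambda>\<omega>. \<bar>real_cond_exp M F X \<omega>\<bar> powr p) \<le> expectation (\<lambda>\<omega>. \<bar>X \<omega>\<bar> powr p)"
    using integral_mono_AE[OF * int(1) ae] int(2) by simp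
qed

text \<open>Some level K makes all tail moments less than 1; below K the integrand is at most K^q.
  The estimate runs in the extended integral because integrability is not known beforehand but
  results from it.\<close>

lemma kernel_moment_bound:
  assumes W: "\<And>i. 1 \<le> i \<Longrightarrow> W i \<in> measurable M S"
    and phi [measurable]: "(\<lambda>(x, y). \<phi> x y) \<in> borel_measurable (S \<Otimes>\<^sub>M S)"
    and ui: "kernel_unif_integrable M W \<phi> q" and q: "0 \<le> q"
  obtains B where "0 \<le> B"
    "\<And>i j. 1 \<le> i \<Longrightarrow> 1 \<le> j \<Longrightarrow> integrable M (\<lambda>\<omega>. \<bar>\<phi> (W i \<omega>) (W j \<omega>)\<bar> powr q)"
    "\<And>i j. 1 \<le> i \<Longrightarrow> 1 \<le> j \<Longrightarrow> expectation (\<lambda>\<omega>. \<bar>\<phi> (W i \<omega>) (W j \<omega>)\<bar> powr q) \<le> B"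
proof -
  let ?I = "\<lambda>K i j. \<integral>\<^sup>+ \<omega>. ennreal (\<bar>\<phi> (W i \<omega>) (W j \<omega>)\<bar> powr q
                  * indicator {K<..} \<bar>\<phi> (W i \<omega>) (W j \<omega>)\<bar>) \<partial>M"
  let ?F = "\<lambda>K. SUP n::nat. SUP i\<in>{1..n}. SUP j\<in>{1..n}. ?I K i j"
  have "eventually (\<lambda>K. ?F K < 1) at_top"
    using ui unfolding kernel_unif_integrable_def by (rule order_tendstoD) simp
  then have "eventually (\<lambda>K. ?F K < 1 \<and> 0 \<le> K) at_top"
    using eventually_ge_at_top[of 0] by eventually_elim simp
  then obtain K where K: "?F K < 1" "0 \<le> K"
    using eventually_happens'[OF trivial_limit_at_top_linorder] by blast
  let ?f = "\<lambda>i j \<omega>. \<bar>\<phi> (W i \<omega>) (W j \<omega>)\<bar>"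
  have "integrable M (\<lambda>\<omega>. ?f i j \<omega> powr q) \<and> expectation (\<lambda>\<omega>. ?f i j \<omega> powr q) \<le> K powr q + 1"
    if ij: "1 \<le> i" "1 \<le> j" for i j
  proof -
    have [measurable]: "W i \<in> measurable M S" "W j \<in> measurable M S" using W ij by auto
    \<comment> \<open>The row n = max i j contains both indices, so the supremum reaches every
      pair.\<close>
    have "?I K i j \<le> ?F K"
      by (rule SUP_upper2[of "max i j"], simp, rule SUP_upper2[of i], use ij in simp,
          rule SUP_upper2[of j], use ij in auto)
    then have I: "?I K i j \<le> 1" using K(1) by order
    have "(\<integral>\<^sup>+ \<omega>. ennreal (?f i j \<omega> powr q) \<partial>M) \<le>
        (\<integral>\<^sup>+ \<omega>. ennreal (K powr q) + ennreal (?f i j \<omega> powr q * indicator {K<..} (?f i j \<omega>)) \<partial>M)"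
    proof (rule nn_integral_mono)
      fix \<omega>
      have "?f i j \<omega> powr q \<le> K powr q + ?f i j \<omega> powr q * indicator {K<..} (?f i j \<omega>)"
        using q powr_mono2[of q "?f i j \<omega>" K] by (auto simp: indicator_def)
      then show "ennreal (?f i j \<omega> powr q) \<le> ennreal (K powr q) + ennreal (?f i j \<omega> powr q * indicator {K<..} (?f i j \<omega>))"
        by (metis ennreal_leI ennreal_plus indicator_pos_le mult_nonneg_nonneg powr_ge_zero)
    qed
    also have "\<dots> = ennreal (K powr q) + ?I K i j"
      by (subst nn_integral_add) (auto simp: emeasure_space_1)
    also have "\<dots> \<le> ennreal (K powr q) + 1" using I by (intro add_left_mono)
    also have "\<dots> = ennreal (K powr q + 1)" by simp
    finally have le: "(\<integral>\<^sup>+ \<omega>. ennreal (?f i j \<omega> powr q) \<partial>M) \<le> ennreal (K powr q + 1)" .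
    have int: "integrable M (\<lambda>\<omega>. ?f i j \<omega> powr q)"
      by (rule integrableI_bounded) (use le in \<open>auto intro: le_less_trans\<close>)
    moreover have "expectation (\<lambda>\<omega>. ?f i j \<omega> powr q) \<le> K powr q + 1"
      using le nn_integral_eq_integral[OF int] by (simp add: ennreal_le_iff del: ennreal_plus)
    ultimately show ?thesis by blast
  qed
  then show ?thesis by (intro that[of "K powr q + 1"]) auto
qed

end

section \<open>The Hoeffding decomposition\<close>

context m_dependent_sequence
begin

lemma card_near: "card {j \<in> A. near i j} \<le> 2 * m + 1"
proof -
  have "{j \<in> A. near i j} \<subseteq> {i - m..i + m}" by (auto simp: near_def)
  then have "card {j \<in> A. near i j} \<le> card {i - m..i + m}" by (intro card_mono) auto
  then show ?thesis by simp
qed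

text \<open>Stated over normed fields so as to serve both real products of projections and the
  complex exponentials of the limit theorem.\<close>

lemma expectation_mult_isolated:
  fixes X Y :: "'a \<Rightarrow> 'c :: {real_normed_field, banach, second_countable_topology}"
  assumes "1 \<le> k" "\<And>b. b \<in> B \<Longrightarrow> 1 \<le> b" "\<And>b. b \<in> B \<Longrightarrow> \<not> near k b"
    and X: "X \<in> borel_measurable (gs {k})" "integrable M X"
    and Y: "Y \<in> borel_measurable (gs B)" "integrable M Y"
  shows "expectation (\<lambda>\<omega>. X \<omega> * Y \<omega>) = expectation X * expectation Y"
proof (rule indep_var_lebesgue_integral)
  show "indep_var borel X borel Y"
    by (rule indep_var_gs[OF _ _ indep_isolated]) (use assms in auto)
qed (use X Y in auto)

end

text \<open>B2 is the form in which uniform integrability enters the decomposition; it bounds all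
  pairs, including the near pairs, on which no centring is available.\<close>

locale m_dependent_kernel = m_dependent_sequence +
  fixes \<phi> :: "'b \<Rightarrow> 'b \<Rightarrow> real" and B2 :: real
  assumes phi_meas [measurable]: "(\<lambda>(x, y). \<phi> x y) \<in> borel_measurable (S \<Otimes>\<^sub>M S)"
    and phi_sym: "x \<in> space S \<Longrightarrow> y \<in> space S \<Longrightarrow> \<phi> x y = \<phi> y x"
    and centred: "lag_centred M m W \<phi>"
    and phi_sq_int: "1 \<le> i \<Longrightarrow> 1 \<le> j \<Longrightarrow> integrable M (\<lambda>\<omega>. (\<phi> (W i \<omega>) (W j \<omega>))\<^sup>2)"
    and phi_sq_le: "1 \<le> i \<Longrightarrow> 1 \<le> j \<Longrightarrow> expectation (\<lambda>\<omega>. (\<phi> (W i \<omega>) (W j \<omega>))\<^sup>2) \<le> B2"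
begin

abbreviation h :: "nat \<Rightarrow> nat \<Rightarrow> 'a \<Rightarrow> real" where
  "h i j \<omega> \<equiv> \<phi> (W i \<omega>) (W j \<omega>)"

text \<open>The order of arguments is reversed against \<open>proj1\<close>: here the first index is
  the conditioning one, so \<open>p i j\<close> is a function of W_i.\<close>

definition p :: "nat \<Rightarrow> nat \<Rightarrow> 'a \<Rightarrow> real" where
  "p i j = proj1 M S W \<phi> j i"

text \<open>The Hoeffding remainder. No mean is added back since the kernel is centred on far pairs,
  the only ones over which \<open>d\<close> is summed.\<close>

definition d :: "nat \<Rightarrow> nat \<Rightarrow> 'a \<Rightarrow> real" where
  "d i j \<omega> = h i j \<omega> - p i j \<omega> - p j i \<omega>"

abbreviation avg :: "nat \<Rightarrow> nat \<Rightarrow> 'a \<Rightarrow> real" where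
  "avg n i \<equiv> avg_proj1 M S W \<phi> n m i"

lemma B2_nonneg: "0 \<le> B2"
proof -
  have "0 \<le> expectation (\<lambda>\<omega>. (h 1 1 \<omega>)\<^sup>2)" by simp
  also have "\<dots> \<le> B2" by (rule phi_sq_le) auto
  finally show ?thesis .
qed

lemma h_sym: "1 \<le> i \<Longrightarrow> 1 \<le> j \<Longrightarrow> \<omega> \<in> space M \<Longrightarrow> h i j \<omega> = h j i \<omega>"
  using W_measurable[of i] W_measurable[of j] by (intro phi_sym) (auto dest: measurable_space)

lemma h_measurable_gs: 
  assumes "1 \<le> i" "1 \<le> j" "i \<in> I" "j \<in> I"
  shows "h i j \<in> borel_measurable (gs I)"
  using W_measurable_gs[OF assms(3,1)] W_measurable_gs[OF assms(4,2)] by measurable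

lemma p_measurable_gs: "i \<in> I \<Longrightarrow> p i j \<in> borel_measurable (gs I)"
  unfolding p_def proj1_def by (rule measurable_gs_mono[of "{i}"]) auto

lemma d_measurable_gs:
  assumes "1 \<le> i" "1 \<le> j" "i \<in> I" "j \<in> I"
  shows "d i j \<in> borel_measurable (gs I)"
  unfolding d_def [abs_def] using h_measurable_gs[OF assms] assms
  by (intro borel_measurable_diff p_measurable_gs) auto

lemma square_integrable_h: "1 \<le> i \<Longrightarrow> 1 \<le> j \<Longrightarrow> square_integrable (h i j)"
  using phi_sq_int W_measurable[of i] W_measurable[of j] by (auto simp: square_integrable_def)

lemma p_powr_moment:
  assumes ij: "1 \<le> i" "1 \<le> j" and q: "1 \<le> q"
    and int: "integrable M (\<lambda>\<omega>. \<bar>h i j \<omega>\<bar> powr q)"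
  shows "integrable M (\<lambda>\<omega>. \<bar>p i j \<omega>\<bar> powr q)"
    and "expectation (\<lambda>\<omega>. \<bar>p i j \<omega>\<bar> powr q) \<le> expectation (\<lambda>\<omega>. \<bar>h i j \<omega>\<bar> powr q)"
proof -
  have s: "subalgebra M (gs {i})" using ij by (intro subalgebra_gs) auto
  note * = cond_exp_powr_moment[OF s q square_integrable_integrable[OF square_integrable_h[OF ij]] int]
  show "integrable M (\<lambda>\<omega>. \<bar>p i j \<omega>\<bar> powr q)"
    "expectation (\<lambda>\<omega>. \<bar>p i j \<omega>\<bar> powr q) \<le> expectation (\<lambda>\<omega>. \<bar>h i j \<omega>\<bar> powr q)"
    using * unfolding p_def proj1_def .
qed

lemma square_integrable_p:
  assumes ij: "1 \<le> i" "1 \<le> j"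
  shows "square_integrable (p i j)" "expectation (\<lambda>\<omega>. (p i j \<omega>)\<^sup>2) \<le> B2"
  using p_powr_moment[OF ij, of 2] phi_sq_int[OF ij] phi_sq_le[OF ij] 
    measurable_gs_M[OF _ p_measurable_gs[of i "{i}" j]] ij
  by (auto simp: square_integrable_def)

lemma expectation_p: 
  assumes ij: "1 \<le> i" "1 \<le> j" "\<not> near i j"
  shows "expectation (p i j) = 0"
proof -
  have s: "subalgebra M (gs {i})" using ij by (intro subalgebra_gs) auto
  interpret F: finite_measure_subalgebra M "gs {i}" by unfold_locales (rule s)
  have "expectation (p i j) = expectation (h i j)"
    unfolding p_def proj1_def
    by (rule F.real_cond_exp_int(2)[OF square_integrable_integrable[OF square_integrable_h[OF ij(1,2)]]])
  then show ?thesis using centred ij by (auto simp: lag_centred_def near_def)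
qed

lemma square_integrable_d:
  assumes ij: "1 \<le> i" "1 \<le> j"
  shows "square_integrable (d i j)" "expectation (\<lambda>\<omega>. (d i j \<omega>)\<^sup>2) \<le> 9 * B2"
proof -
  note sq = square_integrable_h[OF ij] square_integrable_p(1)[OF ij] square_integrable_p(1)[OF ij(2,1)]
  show *: "square_integrable (d i j)" unfolding d_def [abs_def]
    by (intro square_integrable_diff sq)
  \<comment> \<open>Right side minus left side is (a + b)^2 + (a + c)^2 + (b - c)^2. With three
    second moments of at most B2 each, the constant becomes 3 * 3 = 9.\<close>
  have le: "(a - b - c)\<^sup>2 \<le> 3 * (a\<^sup>2 + b\<^sup>2 + c\<^sup>2)" for a b c :: real
    using zero_le_power2[of "a + b"] zero_le_power2[of "a + c"] zero_le_power2[of "b - c"]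
    by (simp add: power2_eq_square algebra_simps)
  have "expectation (\<lambda>\<omega>. (d i j \<omega>)\<^sup>2) \<le> expectation (\<lambda>\<omega>. 3 * ((h i j \<omega>)\<^sup>2 + (p i j \<omega>)\<^sup>2 + (p j i \<omega>)\<^sup>2))"
  proof (rule integral_mono)
    show "(d i j \<omega>)\<^sup>2 \<le> 3 * ((h i j \<omega>)\<^sup>2 + (p i j \<omega>)\<^sup>2 + (p j i \<omega>)\<^sup>2)" for \<omega>
      unfolding d_def by (rule le)
  qed (use * sq in \<open>auto simp: square_integrable_def\<close>)
  also have "\<dots> \<le> 3 * (B2 + B2 + B2)"
    using sq phi_sq_le[OF ij] square_integrable_p(2)[OF ij] square_integrable_p(2)[OF ij(2,1)]
    by (simp add: square_integrable_def)
  finally show "expectation (\<lambda>\<omega>. (d i j \<omega>)\<^sup>2) \<le> 9 * B2" by simp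
qed

text \<open>Given all of \<open>W i\<close>, \<open>W j\<close>, \<open>W l\<close>, the variable \<open>W k\<close> keeps its law, so that
  \<open>d k l\<close> has conditional mean zero.\<close>

lemma d_orthogonal:
  assumes pos: "1 \<le> i" "1 \<le> j" "1 \<le> k" "1 \<le> l"
    and iso: "\<not> near k i" "\<not> near k j" "\<not> near k l"
  shows "expectation (\<lambda>\<omega>. d i j \<omega> * d k l \<omega>) = 0" "expectation (\<lambda>\<omega>. d i j \<omega> * d l k \<omega>) = 0"
proof -
  let ?B = "{i, j, l}"
  have B: "\<And>b. b \<in> ?B \<Longrightarrow> 1 \<le> b" "\<And>b. b \<in> ?B \<Longrightarrow> \<not> near k b" using assms by auto
  have c: "d i j \<in> borel_measurable (gs ?B)" using pos by (intro d_measurable_gs) auto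
  note sqd = square_integrable_d(1)[OF pos(1,2)]
  note int = integrable_mult_square_integrable[OF sqd]
  note intp = int[OF square_integrable_p(1)[OF pos(3,4)]] int[OF square_integrable_p(1)[OF pos(4,3)]]
  \<comment> \<open>Integrating out W_k replaces the kernel by \<open>p l k\<close>, which cancels
    against the projection subtracted in \<open>d\<close>.\<close>
  have 1: "expectation (\<lambda>\<omega>. d i j \<omega> * h l k \<omega>) = expectation (\<lambda>\<omega>. d i j \<omega> * p l k \<omega>)"
    unfolding p_def
    by (rule decouple(2)[OF phi_meas pos(3) B _ c])
       (use int[OF square_integrable_h[OF pos(4,3)]] square_integrable_integrable[OF square_integrable_h[OF pos(4,3)]] in auto)
  \<comment> \<open>The other projection depends on W_k alone, so it is independent of
    \<open>d i j\<close>, and it is centred because k and l are far apart.\<close>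
  have "expectation (\<lambda>\<omega>. p k l \<omega> * d i j \<omega>) = expectation (p k l) * expectation (d i j)"
    using pos B c sqd square_integrable_p(1)[OF pos(3,4)]
    by (intro expectation_mult_isolated[of k ?B] p_measurable_gs square_integrable_integrable) auto
  then have 2: "expectation (\<lambda>\<omega>. d i j \<omega> * p k l \<omega>) = 0"
    using expectation_p[OF pos(3,4) iso(3)] by (simp add: mult.commute)
  have "expectation (\<lambda>\<omega>. d i j \<omega> * d l k \<omega>)
      = expectation (\<lambda>\<omega>. d i j \<omega> * h l k \<omega> - d i j \<omega> * p l k \<omega> - d i j \<omega> * p k l \<omega>)"
    by (simp add: d_def algebra_simps)
  also have "\<dots> = 0"
    using 1 2 int[OF square_integrable_h[OF pos(4,3)]] intp by simp
  finally show *: "expectation (\<lambda>\<omega>. d i j \<omega> * d l k \<omega>) = 0" .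
  \<comment> \<open>\<open>d\<close> is symmetric, by symmetry of the kernel, so the isolated index
    may stand in either place.\<close>
  have "expectation (\<lambda>\<omega>. d i j \<omega> * d k l \<omega>) = expectation (\<lambda>\<omega>. d i j \<omega> * d l k \<omega>)"
    using h_sym pos by (intro Bochner_Integration.integral_cong) (auto simp: d_def)
  then show "expectation (\<lambda>\<omega>. d i j \<omega> * d k l \<omega>) = 0" using * by simp
qed

section \<open>The degenerate sum\<close>

definition far_pairs :: "nat \<Rightarrow> (nat \<times> nat) set" where
  "far_pairs n = {(i, j) \<in> {1..n} \<times> {1..n}. \<not> near i j}"

definition near_pairs :: "nat \<Rightarrow> (nat \<times> nat) set" where
  "near_pairs n = {(i, j) \<in> {1..n} \<times> {1..n}. near i j \<and> i \<noteq> j}"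

lemma finite_pairs [simp]: "finite (far_pairs n)" "finite (near_pairs n)"
  by (auto simp: far_pairs_def near_pairs_def intro: finite_subset[of _ "{1..n} \<times> {1..n}"])

lemma card_far_pairs: "card (far_pairs n) \<le> n * n"
proof -
  have "card (far_pairs n) \<le> card ({1..n} \<times> {1..n})"
    by (intro card_mono) (auto simp: far_pairs_def)
  then show ?thesis by simp
qed

lemma card_near_pairs: "card (near_pairs n) \<le> n * (2 * m + 1)"
proof -
  have "card (near_pairs n) \<le> card (SIGMA i:{1..n}. {j \<in> {1..n}. near i j})"
    by (intro card_mono) (auto simp: near_pairs_def)
  also have "\<dots> \<le> (\<Sum>i\<in>{1..n}. 2 * m + 1)"
    by (subst card_SigmaI, simp, simp, rule sum_mono, rule card_near)
  finally show ?thesis by simp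
qed

text \<open>With L = 2m + 1, at most 2L indices are near one of the two members of a pair, hence at
  most (2L)^2 pairs can correlate with it. The second moment is at most n^2 (2L)^2 9 B2, the square
  of 6 n L sqrt B2.\<close>

lemma degenerate_L1:
  "expectation (\<lambda>\<omega>. \<bar>\<Sum>(i, j)\<in>far_pairs n. d i j \<omega>\<bar>) \<le> 6 * real n * real (2 * m + 1) * sqrt B2"
proof -
  let ?L = "2 * m + 1"
  define N where "N = (\<lambda>(i, j). {k \<in> {1..n}. near i k \<or> near j k})"
  have finN: "finite (N a)" for a by (cases a) (simp add: N_def)
  have cN: "card (N a) \<le> 2 * ?L" for a
  proof (cases a)
    case (Pair i j)
    have "N a = {k \<in> {1..n}. near i k} \<union> {k \<in> {1..n}. near j k}" by (auto simp: N_def Pair)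
    then have "card (N a) \<le> card {k \<in> {1..n}. near i k} + card {k \<in> {1..n}. near j k}"
      by (simp add: card_Un_le)
    also have "\<dots> \<le> ?L + ?L" by (intro add_mono card_near)
    finally show ?thesis by simp
  qed
  have sq: "square_integrable (\<lambda>\<omega>. \<Sum>(i, j)\<in>far_pairs n. d i j \<omega>)"
    using square_integrable_d(1) by (auto intro!: square_integrable_sum simp: far_pairs_def)
  have "expectation (\<lambda>\<omega>. (\<Sum>a\<in>far_pairs n. case_prod d a \<omega>)\<^sup>2) \<le>
      real (card (far_pairs n)) * real ((2 * ?L) * (2 * ?L)) * (9 * B2)"
  proof (rule expectation_square_sum_le[where R = "\<lambda>a. N a \<times> N a"])
    fix a assume a: "a \<in> far_pairs n"
    have "card (far_pairs n \<inter> N a \<times> N a) \<le> card (N a \<times> N a)"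
      using finN by (intro card_mono) auto
    also have "\<dots> \<le> (2 * ?L) * (2 * ?L)"
      unfolding card_cartesian_product using cN by (intro mult_mono) auto
    finally show "card (far_pairs n \<inter> N a \<times> N a) \<le> (2 * ?L) * (2 * ?L)" .
    fix b assume b: "b \<in> far_pairs n" "b \<notin> N a \<times> N a"
    obtain i j k l where [simp]: "a = (i, j)" "b = (k, l)" by (cases a, cases b)
    have pos: "1 \<le> i" "1 \<le> j" "1 \<le> k" "1 \<le> l" and kl: "\<not> near k l" "\<not> near l k"
      using a b by (auto simp: far_pairs_def dest: near_sym)
    \<comment> \<open>One of k, l is away from both i and j; since (k, l) is a far pair, this index
      is away from its own partner too, hence isolated.\<close>
    have "(\<not> near i k \<and> \<not> near j k) \<or> (\<not> near i l \<and> \<not> near j l)"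
      using b by (auto simp: N_def far_pairs_def)
    then show "expectation (\<lambda>\<omega>. case_prod d a \<omega> * case_prod d b \<omega>) = 0"
      using d_orthogonal(1)[OF pos] d_orthogonal(2)[of i j l k] pos kl near_sym by auto
  next
    show "square_integrable (case_prod d a)" "expectation (\<lambda>\<omega>. (case_prod d a \<omega>)\<^sup>2) \<le> 9 * B2"
      if "a \<in> far_pairs n" for a
      using that square_integrable_d by (auto simp: far_pairs_def)
  qed (use B2_nonneg in auto)
  also have "\<dots> \<le> real (n * n) * real ((2 * ?L) * (2 * ?L)) * (9 * B2)"
    using B2_nonneg card_far_pairs by (intro mult_right_mono) (auto simp flip: of_nat_mult)
  also have "\<dots> = (6 * real n * real ?L)\<^sup>2 * B2" by (simp add: power2_eq_square algebra_simps)
  finally have "expectation (\<lambda>\<omega>. \<bar>\<Sum>(i, j)\<in>far_pairs n. d i j \<omega>\<bar>) \<le> sqrt ((6 * real n * real ?L)\<^sup>2 * B2)"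
    using sq by (intro expectation_abs_le_sqrt) (auto simp: case_prod_unfold)
  then show ?thesis by (simp add: real_sqrt_mult)
qed

section \<open>The averaged projections\<close>

lemma avg_eq:
  "avg n i \<omega> = (\<Sum>j\<in>{j \<in> {1..n}. \<not> near i j}. p i j \<omega>) / real (card {j \<in> {1..n}. \<not> near i j})"
proof -
  \<comment> \<open>Removing i changes nothing, because i is near itself; numerator and
    \<open>lag_count\<close> thus range over the same set.\<close>
  have "{j \<in> {1..n} - {i}. \<bar>int i - int j\<bar> > int m} = {j \<in> {1..n}. \<not> near i j}"
    "{j \<in> {1..n}. \<bar>int i - int j\<bar> > int m} = {j \<in> {1..n}. \<not> near i j}"
    by (auto simp: near_def)
  then show ?thesis by (simp add: avg_proj1_def lag_count_def p_def)
qed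

lemma avg_measurable_gs: "i \<in> I \<Longrightarrow> avg n i \<in> borel_measurable (gs I)"
  unfolding avg_eq [abs_def] by (intro borel_measurable_divide borel_measurable_sum p_measurable_gs) auto

lemma avg_powr_moment:
  assumes i: "1 \<le> i" and q: "1 \<le> q" and B: "0 \<le> B"
    and int: "\<And>j. 1 \<le> j \<Longrightarrow> integrable M (\<lambda>\<omega>. \<bar>h i j \<omega>\<bar> powr q)"
    and le: "\<And>j. 1 \<le> j \<Longrightarrow> expectation (\<lambda>\<omega>. \<bar>h i j \<omega>\<bar> powr q) \<le> B"
  shows "integrable M (\<lambda>\<omega>. \<bar>avg n i \<omega>\<bar> powr q)" "expectation (\<lambda>\<omega>. \<bar>avg n i \<omega>\<bar> powr q) \<le> B"
proof -
  let ?A = "{j \<in> {1..n}. \<not> near i j}"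
  note P = p_powr_moment[OF i _ q]
  have intp: "integrable M (\<lambda>\<omega>. (\<Sum>j\<in>?A. \<bar>p i j \<omega>\<bar> powr q) / card ?A)"
    by (intro integrable_divide_zero Bochner_Integration.integrable_sum impI P(1) int) auto
  have pw: "\<bar>avg n i \<omega>\<bar> powr q \<le> (\<Sum>j\<in>?A. \<bar>p i j \<omega>\<bar> powr q) / card ?A" for \<omega>
    unfolding avg_eq by (rule abs_mean_powr_le[OF q]) simp
  have [measurable]: "avg n i \<in> borel_measurable M"
    using measurable_gs_M[OF _ avg_measurable_gs[of i "{i}"]] i by auto
  show *: "integrable M (\<lambda>\<omega>. \<bar>avg n i \<omega>\<bar> powr q)"
    by (rule Bochner_Integration.integrable_bound[OF intp])
       (use order_trans[OF pw abs_ge_self] in \<open>auto intro!: AE_I2 simp del: abs_divide\<close>)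
  have "expectation (\<lambda>\<omega>. \<bar>avg n i \<omega>\<bar> powr q) \<le> expectation (\<lambda>\<omega>. (\<Sum>j\<in>?A. \<bar>p i j \<omega>\<bar> powr q) / card ?A)"
    by (rule integral_mono[OF * intp pw])
  also have "\<dots> = (\<Sum>j\<in>?A. expectation (\<lambda>\<omega>. \<bar>p i j \<omega>\<bar> powr q)) / card ?A"
    using P(1) int by (subst integral_divide_zero, subst Bochner_Integration.integral_sum) auto
  also have "\<dots> \<le> (\<Sum>j\<in>?A. B) / card ?A"
    using P(2) int le by (intro divide_right_mono sum_mono) (auto intro: order_trans)
  \<comment> \<open>For an empty index set the quotient is 0 by division by zero, and nonnegativity
    of B suffices.\<close>
  also have "\<dots> \<le> B" using B by simp
  finally show "expectation (\<lambda>\<omega>. \<bar>avg n i \<omega>\<bar> powr q) \<le> B" .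
qed

lemma square_integrable_avg:
  assumes i: "1 \<le> i" 
  shows "square_integrable (avg n i)" "expectation (\<lambda>\<omega>. (avg n i \<omega>)\<^sup>2) \<le> B2"
  using avg_powr_moment[OF i, of 2 B2 n] phi_sq_int[OF i] phi_sq_le[OF i] B2_nonneg
    measurable_gs_M[OF _ avg_measurable_gs[of i "{i}" n]] i
  by (auto simp: square_integrable_def)

lemma expectation_avg: 
  assumes "1 \<le> i"
  shows "expectation (avg n i) = 0"
proof -
  have "expectation (avg n i) = (\<Sum>j\<in>{j \<in> {1..n}. \<not> near i j}. expectation (p i j)) / real (card {j \<in> {1..n}. \<not> near i j})"
    unfolding avg_eq [abs_def] using square_integrable_p(1)[OF assms] square_integrable_integrable
    by (subst integral_divide_zero, subst Bochner_Integration.integral_sum) auto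
  then show ?thesis using expectation_p[OF assms] by simp
qed

lemma expectation_avg_mult:
  assumes "1 \<le> i" "1 \<le> j" "\<not> near i j"
  shows "expectation (\<lambda>\<omega>. avg n i \<omega> * avg n j \<omega>) = 0"
  using expectation_mult_isolated[of i "{j}" "avg n i" "avg n j"] assms expectation_avg
    square_integrable_avg(1) by (auto simp: avg_measurable_gs square_integrable_integrable)

section \<open>The remainder after projection\<close>

lemma U_stat_measurable: "U_stat W \<phi> n \<in> borel_measurable M"
  unfolding U_stat_def [abs_def] using square_integrable_h square_integrable_measurable by auto

lemma avg_measurable: "1 \<le> i \<Longrightarrow> avg n i \<in> borel_measurable M"
  using square_integrable_avg(1) square_integrable_measurable by auto

lemma sum_avg_square:
  "expectation (\<lambda>\<omega>. (\<Sum>i\<in>{1..n}. avg n i \<omega>)\<^sup>2) \<le> real n * real (2 * m + 1) * B2"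
proof -
  have "expectation (\<lambda>\<omega>. (\<Sum>i\<in>{1..n}. avg n i \<omega>)\<^sup>2) \<le> real (card {1..n}) * real (2 * m + 1) * B2"
  proof (rule expectation_square_sum_le[where R = "\<lambda>i. {j. near i j}"])
    show "card ({1..n} \<inter> {j. near i j}) \<le> 2 * m + 1" for i
      using card_near[of "{1..n}" i] by (simp add: Int_def)
  qed (use B2_nonneg square_integrable_avg expectation_avg_mult in auto)
  then show ?thesis by simp
qed

text \<open>Clearing the denominator keeps this an exact identity. The last sum is the price of
  averaging over Q_i indices while U divides by n - 1.\<close>

lemma U_stat_decomp:
  assumes n: "2 \<le> n" and \<omega>: "\<omega> \<in> space M"
  shows "real n * (real n - 1) * (U_stat W \<phi> n \<omega> - 2 / real n * (\<Sum>i\<in>{1..n}. avg n i \<omega>)) =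
    (\<Sum>(i, j)\<in>near_pairs n. h i j \<omega>) + (\<Sum>(i, j)\<in>far_pairs n. d i j \<omega>)
    + 2 * (\<Sum>i\<in>{1..n}. (real (card {j \<in> {1..n}. \<not> near i j}) - (real n - 1)) * avg n i \<omega>)"
proof -
  have far: "far_pairs n = (SIGMA i:{1..n}. {j \<in> {1..n}. \<not> near i j})" by (auto simp: far_pairs_def)
  have "(\<Sum>i\<in>{1..n}. \<Sum>j\<in>{1..n} - {i}. h i j \<omega>) = (\<Sum>(i, j)\<in>(SIGMA i:{1..n}. {1..n} - {i}). h i j \<omega>)"
    by (subst sum.Sigma) auto
  also have "(SIGMA i:{1..n}. {1..n} - {i}) = near_pairs n \<union> far_pairs n"
    by (auto simp: near_pairs_def far_pairs_def)
  also have "(\<Sum>(i, j)\<in>near_pairs n \<union> far_pairs n. h i j \<omega>) = 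
      (\<Sum>(i, j)\<in>near_pairs n. h i j \<omega>) + (\<Sum>(i, j)\<in>far_pairs n. h i j \<omega>)"
    by (subst sum.union_disjoint, simp, simp) (auto simp: near_pairs_def far_pairs_def)
  also have "(\<Sum>(i, j)\<in>far_pairs n. h i j \<omega>) = (\<Sum>(i, j)\<in>far_pairs n. d i j \<omega>)
      + (\<Sum>(i, j)\<in>far_pairs n. p i j \<omega>) + (\<Sum>(i, j)\<in>far_pairs n. p j i \<omega>)"
    by (simp add: d_def case_prod_unfold flip: sum.distrib)
  \<comment> \<open>Swapping the two indices preserves the set of far pairs, so both projections
    contribute equally; hence the factor 2.\<close>
  also have "(\<Sum>(i, j)\<in>far_pairs n. p j i \<omega>) = (\<Sum>(i, j)\<in>far_pairs n. p i j \<omega>)"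
    by (rule sum.reindex_bij_witness[of _ prod.swap prod.swap]) (auto simp: far_pairs_def dest: near_sym)
  \<comment> \<open>Multiplying by Q_i undoes the averaging; for Q_i = 0 both the inner sum and the
    product are 0.\<close>
  also have "(\<Sum>(i, j)\<in>far_pairs n. p i j \<omega>) = 
      (\<Sum>i\<in>{1..n}. real (card {j \<in> {1..n}. \<not> near i j}) * avg n i \<omega>)"
    unfolding far by (subst sum.Sigma[symmetric], simp, simp, intro sum.cong refl) (auto simp: avg_eq intro: sum.neutral)
  finally have "real n * (real n - 1) * U_stat W \<phi> n \<omega> = (\<Sum>(i, j)\<in>near_pairs n. h i j \<omega>)
      + (\<Sum>(i, j)\<in>far_pairs n. d i j \<omega>) + 2 * (\<Sum>i\<in>{1..n}. real (card {j \<in> {1..n}. \<not> near i j}) * avg n i \<omega>)"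
    using n by (simp add: U_stat_def)
  moreover have "real n * (real n - 1) * (2 / real n * (\<Sum>i\<in>{1..n}. avg n i \<omega>)) =
      2 * (\<Sum>i\<in>{1..n}. (real n - 1) * avg n i \<omega>)"
    using n by (simp add: mult_ac flip: sum_distrib_left)
  ultimately show ?thesis
    by (simp add: left_diff_distrib right_diff_distrib sum_subtractf)
qed

lemma remainder_L1:
  assumes n: "2 \<le> n"
  defines "R \<equiv> \<lambda>\<omega>. U_stat W \<phi> n \<omega> - 2 / real n * (\<Sum>i\<in>{1..n}. avg n i \<omega>)"
  shows "integrable M R" "expectation (\<lambda>\<omega>. \<bar>R \<omega>\<bar>) \<le> 18 * real (2 * m + 1) * sqrt B2 / real n"
proof -
  let ?L = "2 * m + 1" and ?Q = "\<lambda>i. card {j \<in> {1..n}. \<not> near i j}"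
  define H where "H \<omega> = (\<Sum>(i, j)\<in>near_pairs n. h i j \<omega>)" for \<omega>
  define V where "V \<omega> = (\<Sum>(i, j)\<in>far_pairs n. d i j \<omega>)" for \<omega>
  define G where "G \<omega> = (\<Sum>i\<in>{1..n}. (real (?Q i) - (real n - 1)) * avg n i \<omega>)" for \<omega>
  have n1: "0 < real n * (real n - 1)" using n by simp
  have R: "\<bar>R \<omega>\<bar> \<le> (\<bar>H \<omega>\<bar> + \<bar>V \<omega>\<bar> + 2 * \<bar>G \<omega>\<bar>) / (real n * (real n - 1))" if "\<omega> \<in> space M" for \<omega>
  proof -
    have eq: "real n * (real n - 1) * R \<omega> = H \<omega> + V \<omega> + 2 * G \<omega>"
      unfolding R_def H_def V_def G_def by (rule U_stat_decomp[OF n that])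
    have "real n * (real n - 1) * \<bar>R \<omega>\<bar> = \<bar>real n * (real n - 1) * R \<omega>\<bar>"
      using n1 unfolding abs_mult[of "real n * (real n - 1)"] by simp
    also have "\<dots> \<le> \<bar>H \<omega>\<bar> + \<bar>V \<omega>\<bar> + 2 * \<bar>G \<omega>\<bar>" unfolding eq by linarith
    finally have "real n * (real n - 1) * \<bar>R \<omega>\<bar> \<le> \<bar>H \<omega>\<bar> + \<bar>V \<omega>\<bar> + 2 * \<bar>G \<omega>\<bar>" .
    then show ?thesis using n1 by (simp add: field_simps)
  qed
  have sqh: "square_integrable (h i j)" if "(i, j) \<in> near_pairs n" for i j
    using that by (auto intro!: square_integrable_h simp: near_pairs_def)
  have sqH: "square_integrable H" unfolding H_def
    using sqh by (auto intro!: square_integrable_sum)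
  have sqV: "square_integrable V" unfolding V_def
    using square_integrable_d(1) by (auto intro!: square_integrable_sum simp: far_pairs_def)
  have sqG: "square_integrable G" unfolding G_def
    using square_integrable_avg(1) by (auto intro!: square_integrable_sum square_integrable_cmult)
  note ints = sqH[THEN square_integrable_integrable] sqV[THEN square_integrable_integrable]
    sqG[THEN square_integrable_integrable]
  have [measurable]: "R \<in> borel_measurable M" unfolding R_def
    using U_stat_measurable[of n] avg_measurable[of _ n] by auto
  have intb: "integrable M (\<lambda>\<omega>. (\<bar>H \<omega>\<bar> + \<bar>V \<omega>\<bar> + 2 * \<bar>G \<omega>\<bar>) / (real n * (real n - 1)))"
    using ints by auto
  show intR: "integrable M R"
    by (rule Bochner_Integration.integrable_bound[OF intb]) (use R n1 in \<open>auto intro!: AE_I2\<close>)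
  have "expectation (\<lambda>\<omega>. \<bar>H \<omega>\<bar>) \<le> expectation (\<lambda>\<omega>. \<Sum>(i, j)\<in>near_pairs n. \<bar>h i j \<omega>\<bar>)"
    using ints sqh square_integrable_integrable
    by (intro integral_mono) (auto simp: H_def case_prod_unfold intro!: sum_abs)
  also have "\<dots> = (\<Sum>(i, j)\<in>near_pairs n. expectation (\<lambda>\<omega>. \<bar>h i j \<omega>\<bar>))"
    using sqh square_integrable_integrable
    by (subst Bochner_Integration.integral_sum) (auto simp: case_prod_unfold)
  also have "\<dots> \<le> real (card (near_pairs n)) * sqrt B2"
    using square_integrable_h phi_sq_le
    by (intro sum_bounded_above) (auto simp: near_pairs_def intro!: expectation_abs_le_sqrt)
  also have "\<dots> \<le> real (n * ?L) * sqrt B2"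
    using card_near_pairs[of n] B2_nonneg by (intro mult_right_mono) (auto simp flip: of_nat_mult)
  finally have H: "expectation (\<lambda>\<omega>. \<bar>H \<omega>\<bar>) \<le> real n * real ?L * sqrt B2" by (simp add: distrib_left)
  have V: "expectation (\<lambda>\<omega>. \<bar>V \<omega>\<bar>) \<le> 6 * real n * real ?L * sqrt B2"
    unfolding V_def by (rule degenerate_L1)
  \<comment> \<open>The indices missing from Q_i are the near ones, i included; there are between 1
    and 2m + 1 of them, while n - 1 discounts exactly one.\<close>
  have Q: "\<bar>real (?Q i) - (real n - 1)\<bar> \<le> real ?L" if i: "i \<in> {1..n}" for i
  proof -
    have "?Q i + card {j \<in> {1..n}. near i j} = card ({j \<in> {1..n}. \<not> near i j} \<union> {j \<in> {1..n}. near i j})"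
      by (subst card_Un_disjoint) auto
    also have "{j \<in> {1..n}. \<not> near i j} \<union> {j \<in> {1..n}. near i j} = {1..n}" by auto
    finally have "?Q i + card {j \<in> {1..n}. near i j} = n" by simp
    then show ?thesis using card_near[of "{1..n}" i] by (simp add: abs_le_iff)
  qed
  have inta: "integrable M (avg n i)" if "i \<in> {1..n}" for i
    using that square_integrable_avg(1) square_integrable_integrable by auto
  have "expectation (\<lambda>\<omega>. \<bar>G \<omega>\<bar>) \<le> expectation (\<lambda>\<omega>. \<Sum>i\<in>{1..n}. real ?L * \<bar>avg n i \<omega>\<bar>)"
  proof (intro integral_mono)
    show "\<bar>G \<omega>\<bar> \<le> (\<Sum>i\<in>{1..n}. real ?L * \<bar>avg n i \<omega>\<bar>)" for \<omega>
      unfolding G_def using Q by (intro order_trans[OF sum_abs] sum_mono) (auto simp: abs_mult intro!: mult_right_mono)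
  qed (use ints inta in auto)
  also have "\<dots> = (\<Sum>i\<in>{1..n}. real ?L * expectation (\<lambda>\<omega>. \<bar>avg n i \<omega>\<bar>))"
    using inta by (subst Bochner_Integration.integral_sum) auto
  also have "\<dots> \<le> real (card {1..n}) * (real ?L * sqrt B2)"
    using square_integrable_avg by (intro sum_bounded_above mult_left_mono expectation_abs_le_sqrt) auto
  finally have G: "expectation (\<lambda>\<omega>. \<bar>G \<omega>\<bar>) \<le> real n * real ?L * sqrt B2" by simp
  have "expectation (\<lambda>\<omega>. \<bar>R \<omega>\<bar>) \<le> expectation (\<lambda>\<omega>. (\<bar>H \<omega>\<bar> + \<bar>V \<omega>\<bar> + 2 * \<bar>G \<omega>\<bar>) / (real n * (real n - 1)))"
    using intR intb R by (intro integral_mono) auto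
  also have "\<dots> = (expectation (\<lambda>\<omega>. \<bar>H \<omega>\<bar>) + expectation (\<lambda>\<omega>. \<bar>V \<omega>\<bar>) + 2 * expectation (\<lambda>\<omega>. \<bar>G \<omega>\<bar>)) / (real n * (real n - 1))"
    using ints by simp
  \<comment> \<open>The weights are 1 for near pairs, 6 for the degenerate sum and 2 for the doubled
    discrepancy G.\<close>
  also have "\<dots> \<le> (9 * real n * real ?L * sqrt B2) / (real n * (real n - 1))"
    using H V G n1 by (intro divide_right_mono) auto
  also have "\<dots> = (9 * real ?L * sqrt B2) / (real n - 1)" using n by (simp add: field_simps)
  \<comment> \<open>n - 1 is at least n/2 for n at least 2; this doubles 9 to 18.\<close>
  also have "\<dots> \<le> (9 * real ?L * sqrt B2) / (real n / 2)"
    using n B2_nonneg by (intro divide_left_mono) auto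
  also have "\<dots> = 18 * real ?L * sqrt B2 / real n"
    by (simp add: algebra_simps)
  finally show "expectation (\<lambda>\<omega>. \<bar>R \<omega>\<bar>) \<le> 18 * real ?L * sqrt B2 / real n" .
qed

end

section \<open>Characteristic functions\<close>

text \<open>The remainder is quadratic near 0 and at most linear far away, so any power between 1
  and 2 dominates it. It is applied with exponent q - 1, where third moments need not exist.\<close>

lemma iexp_first_order_remainder:
  assumes q: "1 \<le> q" "q \<le> 2"
  shows "cmod (iexp x - 1 - \<i> * x) \<le> 2 * \<bar>x\<bar> powr q"
proof (cases "\<bar>x\<bar> \<le> 1")
  case True
  have "cmod (iexp x - (1 + \<i> * x)) \<le> \<bar>x\<bar>\<^sup>2 / 2"
    using iexp_approx1[of x 1] by (simp add: numeral_2_eq_2)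
  moreover have "\<bar>x\<bar>\<^sup>2 \<le> \<bar>x\<bar> powr q"
  proof (cases "x = 0")
    case False
    then have "\<bar>x\<bar> powr 2 \<le> \<bar>x\<bar> powr q" using True q by (intro powr_mono') auto
    then show ?thesis using False by simp
  qed simp
  moreover have "0 \<le> \<bar>x\<bar> powr q" "\<bar>x\<bar>\<^sup>2 = x\<^sup>2" by simp_all
  ultimately have "cmod (iexp x - (1 + \<i> * x)) \<le> 2 * \<bar>x\<bar> powr q" by linarith
  then show ?thesis by (simp add: diff_diff_eq)
next
  case False
  have "cmod (iexp x - (1 + \<i> * x)) \<le> 2 * \<bar>x\<bar>"
    using iexp_approx2[of x 1] by simp
  moreover have "\<bar>x\<bar> powr 1 \<le> \<bar>x\<bar> powr q" using False q by (intro powr_mono) auto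
  ultimately show ?thesis using False by (simp add: diff_diff_eq)
qed

text \<open>A crude Young inequality, by passing to the larger of a and b; it avoids Hoelder in the
  moment bounds below.\<close>

lemma mult_powr_le_sum_powr:
  fixes a b :: real
  assumes "0 \<le> a" "0 \<le> b" "0 \<le> s" "0 \<le> t"
  shows "a powr s * b powr t \<le> a powr (s + t) + b powr (s + t)"
proof -
  have "a powr s * b powr t \<le> max a b powr s * max a b powr t"
    using assms by (intro mult_mono powr_mono2) auto
  also have "\<dots> = max a b powr (s + t)" by (simp add: powr_add)
  also have "\<dots> \<le> a powr (s + t) + b powr (s + t)" by (auto simp: max_def)
  finally show ?thesis .
qed

definition clip :: "real \<Rightarrow> real \<Rightarrow> real" where
  "clip K y = max (- K) (min K y)"

lemma clip_measurable [measurable]: "clip K \<in> borel_measurable borel"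
  unfolding clip_def [abs_def] by measurable

lemma abs_clip_le: "0 \<le> K \<Longrightarrow> \<bar>clip K y\<bar> \<le> K"
  by (auto simp: clip_def)

text \<open>The error vanishes below K, and above K one has |y| = |y|^(1 - q) |y|^q with a factor
  that decreases in |y|.\<close>

lemma clip_error:
  assumes K: "0 < K" and q: "1 \<le> q"
  shows "\<bar>y - clip K y\<bar> \<le> K powr (1 - q) * \<bar>y\<bar> powr q"
proof (cases "\<bar>y\<bar> \<le> K")
  case True
  then have "clip K y = y" by (auto simp: clip_def)
  then show ?thesis by simp
next
  case False
  then have "\<bar>y - clip K y\<bar> \<le> \<bar>y\<bar>" using K by (auto simp: clip_def)
  also have "\<dots> = \<bar>y\<bar> powr (1 - q) * \<bar>y\<bar> powr q" using False K by (simp flip: powr_add)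
  also have "\<dots> \<le> K powr (1 - q) * \<bar>y\<bar> powr q"
    using False K q by (intro mult_right_mono powr_mono2') auto
  finally show ?thesis .
qed

context prob_space
begin

lemma integrable_mult_iexp:
  assumes f: "integrable M f" and g [measurable]: "g \<in> borel_measurable M"
  shows "integrable M (\<lambda>\<omega>. complex_of_real (f \<omega>) * iexp (g \<omega>))"
proof (rule Bochner_Integration.integrable_bound[OF f])
  have [measurable]: "f \<in> borel_measurable M" using f by simp
  show "(\<lambda>\<omega>. complex_of_real (f \<omega>) * iexp (g \<omega>)) \<in> borel_measurable M" by measurable
qed (simp add: norm_mult)

text \<open>The second moment V bounds the Taylor error by V t^2 / 2, so the difference quotient
  converges linearly in t and no dominated convergence is needed.\<close>

lemma char_has_vector_derivative:
  assumes Z: "square_integrable Z"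
  shows "((\<lambda>u. expectation (\<lambda>\<omega>. iexp (u * Z \<omega>))) has_vector_derivative
      \<i> * expectation (\<lambda>\<omega>. complex_of_real (Z \<omega>) * iexp (u * Z \<omega>))) (at u)"
    (is "(?psi has_vector_derivative \<i> * ?D) _")
proof -
  have [measurable]: "Z \<in> borel_measurable M" using Z by (simp add: square_integrable_def)
  define V where "V = expectation (\<lambda>\<omega>. (Z \<omega>)\<^sup>2)"
  have i1: "integrable M (\<lambda>\<omega>. iexp (v * Z \<omega>))" for v
    using integrable_mult_iexp[of "\<lambda>_. 1" "\<lambda>\<omega>. v * Z \<omega>"] by simp
  have i2: "integrable M (\<lambda>\<omega>. complex_of_real (Z \<omega>) * iexp (u * Z \<omega>))"
    by (rule integrable_mult_iexp[OF square_integrable_integrable[OF Z]]) simp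
  have bound: "cmod (?psi (u + t) - ?psi u - t * (\<i> * ?D)) \<le> V / 2 * t\<^sup>2" for t
  proof -
    let ?f = "\<lambda>\<omega>. iexp ((u + t) * Z \<omega>) - iexp (u * Z \<omega>)
        - complex_of_real t * (\<i> * (complex_of_real (Z \<omega>) * iexp (u * Z \<omega>)))"
    have pw: "cmod (?f \<omega>) \<le> t\<^sup>2 / 2 * (Z \<omega>)\<^sup>2" for \<omega>
    proof -
      have "?f \<omega> = iexp (u * Z \<omega>) * (iexp (t * Z \<omega>) - (1 + \<i> * (t * Z \<omega>)))"
        by (simp add: algebra_simps exp_add[symmetric])
      then have "cmod (?f \<omega>) = cmod (iexp (t * Z \<omega>) - (1 + \<i> * (t * Z \<omega>)))"
        by (simp add: norm_mult)
      also have "\<dots> \<le> \<bar>t * Z \<omega>\<bar>\<^sup>2 / 2"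
        using iexp_approx1[of "t * Z \<omega>" 1] by (simp add: numeral_2_eq_2)
      finally show ?thesis by (simp add: power_mult_distrib)
    qed
    have "?psi (u + t) - ?psi u - t * (\<i> * ?D) = expectation ?f"
      using i1[of "u + t"] i1[of u] i2 by simp
    also have "cmod \<dots> \<le> expectation (\<lambda>\<omega>. t\<^sup>2 / 2 * (Z \<omega>)\<^sup>2)"
    proof (rule order_trans[OF integral_norm_bound integral_mono])
      show "integrable M (\<lambda>\<omega>. cmod (?f \<omega>))" using i1[of "u + t"] i1[of u] i2 by simp
      show "integrable M (\<lambda>\<omega>. t\<^sup>2 / 2 * (Z \<omega>)\<^sup>2)" using Z by (simp add: square_integrable_def)
    qed (rule pw)
    also have "\<dots> = V / 2 * t\<^sup>2" by (simp add: V_def)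
    finally show ?thesis .
  qed
  have "(\<lambda>t. norm (?psi (u + t) - ?psi u - t *\<^sub>R (\<i> * ?D)) / norm t) \<midarrow>0\<rightarrow> 0"
  proof (rule tendsto_sandwich[of "\<lambda>_. 0"])
    have "norm (?psi (u + t) - ?psi u - t *\<^sub>R (\<i> * ?D)) / norm t \<le> V / 2 * \<bar>t\<bar>" for t
      using divide_right_mono[OF bound[of t], of "\<bar>t\<bar>"] 
      by (cases "t = 0") (auto simp: scaleR_conv_of_real power2_eq_square abs_if split: if_splits)
    then show "\<forall>\<^sub>F t in at 0. norm (?psi (u + t) - ?psi u - t *\<^sub>R (\<i> * ?D)) / norm t \<le> V / 2 * \<bar>t\<bar>"
      by simp
    show "(\<lambda>t::real. V / 2 * \<bar>t\<bar>) \<midarrow>0\<rightarrow> 0"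
      by (auto intro!: tendsto_eq_intros)
  qed auto
  then show ?thesis
    unfolding has_vector_derivative_def has_derivative_at
    by (auto intro: bounded_linear_scaleR_left)
qed

end

section \<open>A central limit theorem for m-dependent arrays\<close>

text \<open>One row of a triangular array, with n fixed; X may therefore depend on n. The cap of 3
  on q keeps q - 1 within the range of \<open>iexp_first_order_remainder\<close>.\<close>

locale m_dependent_row = m_dependent_sequence +
  fixes X :: "nat \<Rightarrow> 'a \<Rightarrow> real" and n :: nat and q B :: real
  assumes X_gs: "i \<in> {1..n} \<Longrightarrow> X i \<in> borel_measurable (gs {i})"
    and q: "2 < q" "q \<le> 3"
    and X_int: "i \<in> {1..n} \<Longrightarrow> integrable M (\<lambda>\<omega>. \<bar>X i \<omega>\<bar> powr q)"
    and X_le: "i \<in> {1..n} \<Longrightarrow> expectation (\<lambda>\<omega>. \<bar>X i \<omega>\<bar> powr q) \<le> B"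
    and B_nonneg: "0 \<le> B"
    and X_mean: "i \<in> {1..n} \<Longrightarrow> expectation (X i) = 0"
begin

abbreviation L :: real where "L \<equiv> real (2 * m + 1)"

definition N :: "nat \<Rightarrow> nat set" where "N i = {j \<in> {1..n}. near i j}"

definition Z :: "'a \<Rightarrow> real" where "Z \<omega> = (\<Sum>i\<in>{1..n}. X i \<omega>)"

definition eta :: "nat \<Rightarrow> 'a \<Rightarrow> real" where "eta i \<omega> = (\<Sum>j\<in>N i. X j \<omega>)"

definition T :: "'a \<Rightarrow> real" where "T \<omega> = (\<Sum>i\<in>{1..n}. X i \<omega> * eta i \<omega>)"

definition s2 :: real where "s2 = expectation (\<lambda>\<omega>. (Z \<omega>)\<^sup>2)"

section \<open>Moments of a row\<close>

lemma N_subset: "N i \<subseteq> {1..n}" and finite_N [simp]: "finite (N i)" and card_N: "real (card (N i)) \<le> L"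
  using card_near[of "{1..n}" i] unfolding N_def by (auto simp flip: of_nat_le_iff)

lemma N_D: "j \<in> N i \<Longrightarrow> j \<in> {1..n}"
  using N_subset by blast

lemma X_measurable: "i \<in> {1..n} \<Longrightarrow> X i \<in> borel_measurable M"
  using X_gs by (intro measurable_gs_M[of "{i}"]) auto

lemma square_integrable_X: "i \<in> {1..n} \<Longrightarrow> square_integrable (X i)"
  using powr_moment_mono(1)[OF X_measurable, of i 2 q B] X_int X_le X_measurable q
  by (auto simp: square_integrable_def)

lemma square_integrable_Z: "square_integrable Z"
  unfolding Z_def [abs_def] using square_integrable_X by (auto intro: square_integrable_sum)

lemma square_integrable_eta: "square_integrable (eta i)"
  unfolding eta_def [abs_def] using square_integrable_X N_D by (auto intro!: square_integrable_sum)

lemma integrable_T: "integrable M T"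
  unfolding T_def [abs_def] using square_integrable_X square_integrable_eta integrable_mult_square_integrable
  by (intro Bochner_Integration.integrable_sum) auto

lemma Z_measurable [measurable]: "Z \<in> borel_measurable M"
  using square_integrable_Z by (rule square_integrable_measurable)

lemma eta_measurable [measurable]: "eta i \<in> borel_measurable M"
  using square_integrable_eta by (rule square_integrable_measurable)

text \<open>The products missing from T pair independent centred variables, so T already carries the
  full variance of Z.\<close>

lemma expectation_T: "expectation T = s2"
proof -
  have int: "integrable M (\<lambda>\<omega>. X i \<omega> * X j \<omega>)" if "i \<in> {1..n}" "j \<in> {1..n}" for i j
    using that square_integrable_X by (auto intro: integrable_mult_square_integrable)
  have 0: "expectation (\<lambda>\<omega>. X i \<omega> * X j \<omega>) = 0" if "i \<in> {1..n}" "j \<in> {1..n}" "\<not> near i j" for i j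
    using that X_mean X_gs square_integrable_X square_integrable_integrable
    by (subst expectation_mult_isolated[of i "{j}"]) auto
  have "expectation T = (\<Sum>i\<in>{1..n}. \<Sum>j\<in>N i. expectation (\<lambda>\<omega>. X i \<omega> * X j \<omega>))"
    unfolding T_def eta_def sum_distrib_left using int N_D
    by (subst Bochner_Integration.integral_sum, force, intro sum.cong refl, 
        subst Bochner_Integration.integral_sum) auto
  also have "\<dots> = (\<Sum>i\<in>{1..n}. \<Sum>j\<in>{1..n}. expectation (\<lambda>\<omega>. X i \<omega> * X j \<omega>))"
    using 0 by (intro sum.cong refl sum.mono_neutral_left) (auto simp: N_def)
  also have "\<dots> = s2"
    unfolding s2_def Z_def power2_eq_square sum_product using int
    by (subst Bochner_Integration.integral_sum, force, intro sum.cong refl, 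
        subst Bochner_Integration.integral_sum) auto
  finally show ?thesis .
qed

text \<open>This is the moment charged by a Taylor remainder of order q - 1 that is multiplied by
  X_i.\<close>

lemma eta_moment:
  assumes i: "i \<in> {1..n}"
  shows "integrable M (\<lambda>\<omega>. \<bar>X i \<omega>\<bar> * \<bar>eta i \<omega>\<bar> powr (q - 1))"
    and "expectation (\<lambda>\<omega>. \<bar>X i \<omega>\<bar> * \<bar>eta i \<omega>\<bar> powr (q - 1)) \<le> B * (1 + L powr q)"
proof -
  let ?c = "real (card (N i))"
  \<comment> \<open>Since i is near itself, the neighbourhood is nonempty and its mean is a genuine
    one.\<close>
  have iN: "i \<in> N i" using i by (simp add: N_def)
  then have c: "0 < ?c" using card_gt_0_iff finite_N by fastforce
  define S where "S \<omega> = (\<Sum>j\<in>N i. \<bar>X j \<omega>\<bar> powr q) / ?c" for \<omega>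
  have intS: "integrable M S" unfolding S_def [abs_def]
    using X_int N_D by (intro integrable_divide_zero Bochner_Integration.integrable_sum) auto
  have ES: "expectation S \<le> B"
  proof -
    have "expectation S = (\<Sum>j\<in>N i. expectation (\<lambda>\<omega>. \<bar>X j \<omega>\<bar> powr q)) / ?c"
      unfolding S_def using X_int N_D
      by (subst integral_divide_zero, subst Bochner_Integration.integral_sum) auto
    also have "\<dots> \<le> (?c * B) / ?c"
      using X_le N_D by (intro divide_right_mono sum_bounded_above) auto
    also have "\<dots> = B" using c by (intro nonzero_mult_div_cancel_left) auto
    finally show ?thesis .
  qed
  have pw: "\<bar>X i \<omega>\<bar> * \<bar>eta i \<omega>\<bar> powr (q - 1) \<le> \<bar>X i \<omega>\<bar> powr q + L powr q * S \<omega>" for \<omega>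
  proof -
    have "\<bar>X i \<omega>\<bar> powr 1 * \<bar>eta i \<omega>\<bar> powr (q - 1) \<le> \<bar>X i \<omega>\<bar> powr (1 + (q - 1)) + \<bar>eta i \<omega>\<bar> powr (1 + (q - 1))"
      using q by (intro mult_powr_le_sum_powr) auto
    then have "\<bar>X i \<omega>\<bar> * \<bar>eta i \<omega>\<bar> powr (q - 1) \<le> \<bar>X i \<omega>\<bar> powr q + \<bar>eta i \<omega>\<bar> powr q"
      by simp
    \<comment> \<open>Writing eta as its number of terms times their mean brings in Jensen, at the
      price of L^q.\<close>
    also have "\<bar>eta i \<omega>\<bar> powr q = ?c powr q * \<bar>(\<Sum>j\<in>N i. X j \<omega>) / ?c\<bar> powr q"
      using c by (simp add: eta_def flip: powr_mult abs_mult)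
    also have "\<dots> \<le> L powr q * S \<omega>"
      unfolding S_def using q card_N[of i]
      by (intro mult_mono powr_mono2 abs_mean_powr_le) auto
    finally show ?thesis by simp
  qed
  have intb: "integrable M (\<lambda>\<omega>. \<bar>X i \<omega>\<bar> powr q + L powr q * S \<omega>)"
    using X_int[OF i] intS by simp
  have [measurable]: "X i \<in> borel_measurable M" by (rule X_measurable[OF i])
  show *: "integrable M (\<lambda>\<omega>. \<bar>X i \<omega>\<bar> * \<bar>eta i \<omega>\<bar> powr (q - 1))"
    by (rule Bochner_Integration.integrable_bound[OF intb])
       (use order_trans[OF pw abs_ge_self] in \<open>auto intro!: AE_I2 simp: abs_mult\<close>)
  have "expectation (\<lambda>\<omega>. \<bar>X i \<omega>\<bar> * \<bar>eta i \<omega>\<bar> powr (q - 1)) \<le> expectation (\<lambda>\<omega>. \<bar>X i \<omega>\<bar> powr q + L powr q * S \<omega>)"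
    by (rule integral_mono[OF * intb pw])
  also have "\<dots> = expectation (\<lambda>\<omega>. \<bar>X i \<omega>\<bar> powr q) + L powr q * expectation S"
    using X_int[OF i] intS by simp
  also have "\<dots> \<le> B + L powr q * B"
    using X_le[OF i] ES by (intro add_mono mult_left_mono) auto
  finally show "expectation (\<lambda>\<omega>. \<bar>X i \<omega>\<bar> * \<bar>eta i \<omega>\<bar> powr (q - 1)) \<le> B * (1 + L powr q)"
    by (simp add: algebra_simps)
qed

lemma stein_summand:
  assumes i: "i \<in> {1..n}"
  shows "cmod (expectation (\<lambda>\<omega>. complex_of_real (X i \<omega>) * iexp (u * Z \<omega>))
      - \<i> * u * expectation (\<lambda>\<omega>. complex_of_real (X i \<omega> * eta i \<omega>) * iexp (u * Z \<omega>)))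
    \<le> 2 * \<bar>u\<bar> powr (q - 1) * (B * (1 + L powr q))"
proof -
  let ?F = "{j \<in> {1..n}. \<not> near i j}"
  have [measurable]: "X i \<in> borel_measurable M" by (rule X_measurable[OF i])
  define Y where "Y \<omega> = iexp (u * (\<Sum>j\<in>?F. X j \<omega>))" for \<omega>
  have Zsplit: "Z \<omega> = (\<Sum>j\<in>?F. X j \<omega>) + eta i \<omega>" for \<omega>
  proof -
    have "{1..n} - N i = ?F" by (auto simp: N_def)
    then show ?thesis
      unfolding Z_def eta_def using sum.subset_diff[OF N_subset, of "\<lambda>j. X j \<omega>" i] by simp
  qed
  have Ygs: "Y \<in> borel_measurable (gs ?F)"
  proof -
    have "X j \<in> borel_measurable (gs ?F)" if "j \<in> ?F" for j
      using that by (intro measurable_gs_mono[OF _ X_gs[of j]]) auto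
    then have sum: "(\<lambda>\<omega>. \<Sum>j\<in>?F. X j \<omega>) \<in> borel_measurable (gs ?F)"
      by (intro borel_measurable_sum)
    have "(\<lambda>x. iexp (u * x)) \<in> borel_measurable borel" by measurable
    from measurable_compose[OF sum this] show ?thesis unfolding Y_def .
  qed
  have YM [measurable]: "Y \<in> borel_measurable M" using Ygs by (rule measurable_gs_M[rotated]) auto
  have intX: "integrable M (X i)" by (intro square_integrable_integrable square_integrable_X i)
  have "expectation (\<lambda>\<omega>. complex_of_real (X i \<omega>) * Y \<omega>) = expectation (\<lambda>\<omega>. complex_of_real (X i \<omega>)) * expectation Y"
  proof (rule expectation_mult_isolated[of i ?F])
    show "(\<lambda>\<omega>. complex_of_real (X i \<omega>)) \<in> borel_measurable (gs {i})" using X_gs[OF i] by measurable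
    show "integrable M Y"
      by (rule integrable_const_bound[of _ 1]) (simp_all add: Y_def)
  qed (use i intX Ygs in auto)
  \<comment> \<open>X_i is independent of the sum over far indices and centred; this term can be
    inserted for free.\<close>
  then have 0: "expectation (\<lambda>\<omega>. complex_of_real (X i \<omega>) * Y \<omega>) = 0"
    using X_mean[OF i] by simp
  have intXe: "integrable M (\<lambda>\<omega>. X i \<omega> * eta i \<omega>)"
    by (intro integrable_mult_square_integrable square_integrable_X square_integrable_eta i)
  have i1: "integrable M (\<lambda>\<omega>. complex_of_real (X i \<omega>) * iexp (u * Z \<omega>))"
    by (rule integrable_mult_iexp[OF intX]) simp
  have i2: "integrable M (\<lambda>\<omega>. complex_of_real (X i \<omega> * eta i \<omega>) * iexp (u * Z \<omega>))"
    by (rule integrable_mult_iexp[OF intXe]) simp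
  have i3: "integrable M (\<lambda>\<omega>. complex_of_real (X i \<omega>) * Y \<omega>)"
    unfolding Y_def
    by (rule integrable_mult_iexp[OF intX]) (use X_measurable in \<open>auto intro!: borel_measurable_sum\<close>)
  \<comment> \<open>With E[X_i Y] = 0 inserted, the integrand factors into X_i, a unimodular number
    and the first-order Taylor remainder of the exponential at - u eta.\<close>
  let ?f = "\<lambda>\<omega>. complex_of_real (X i \<omega>) * Y \<omega> - complex_of_real (X i \<omega>) * iexp (u * Z \<omega>)
      + \<i> * u * (complex_of_real (X i \<omega> * eta i \<omega>) * iexp (u * Z \<omega>))"
  have pw: "cmod (?f \<omega>) \<le> 2 * \<bar>u\<bar> powr (q - 1) * (\<bar>X i \<omega>\<bar> * \<bar>eta i \<omega>\<bar> powr (q - 1))" for \<omega>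
  proof -
    let ?x = "- u * eta i \<omega>"
    have Y: "Y \<omega> = iexp (u * Z \<omega>) * iexp ?x"
      unfolding Y_def Zsplit by (simp add: algebra_simps exp_add[symmetric])
    have "?f \<omega> = complex_of_real (X i \<omega>) * (iexp (u * Z \<omega>) * (iexp ?x - 1 - \<i> * ?x))"
      unfolding Y by (simp add: algebra_simps)
    then have "cmod (?f \<omega>) = \<bar>X i \<omega>\<bar> * cmod (iexp ?x - 1 - \<i> * ?x)"
      by (simp only: norm_mult norm_exp_i_times norm_of_real mult_1_left)
    also have "\<dots> \<le> \<bar>X i \<omega>\<bar> * (2 * \<bar>?x\<bar> powr (q - 1))"
      using q by (intro mult_left_mono iexp_first_order_remainder) auto
    also have "\<bar>?x\<bar> powr (q - 1) = \<bar>u\<bar> powr (q - 1) * \<bar>eta i \<omega>\<bar> powr (q - 1)"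
      by (simp add: abs_mult powr_mult)
    finally show ?thesis by (simp add: mult_ac)
  qed
  have "expectation (\<lambda>\<omega>. complex_of_real (X i \<omega>) * iexp (u * Z \<omega>))
      - \<i> * u * expectation (\<lambda>\<omega>. complex_of_real (X i \<omega> * eta i \<omega>) * iexp (u * Z \<omega>)) = - expectation ?f"
    using i1 i2 i3 0 by simp
  then have "cmod (expectation (\<lambda>\<omega>. complex_of_real (X i \<omega>) * iexp (u * Z \<omega>))
      - \<i> * u * expectation (\<lambda>\<omega>. complex_of_real (X i \<omega> * eta i \<omega>) * iexp (u * Z \<omega>))) = cmod (expectation ?f)"
    by (simp only: norm_minus_cancel)
  also have "\<dots> \<le> expectation (\<lambda>\<omega>. 2 * \<bar>u\<bar> powr (q - 1) * (\<bar>X i \<omega>\<bar> * \<bar>eta i \<omega>\<bar> powr (q - 1)))"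
  proof (rule order_trans[OF integral_norm_bound integral_mono])
    show "integrable M (\<lambda>\<omega>. cmod (?f \<omega>))" using i1 i2 i3 by simp
  qed (use eta_moment(1)[OF i] pw in auto)
  also have "\<dots> = 2 * \<bar>u\<bar> powr (q - 1) * expectation (\<lambda>\<omega>. \<bar>X i \<omega>\<bar> * \<bar>eta i \<omega>\<bar> powr (q - 1))"
    by simp
  also have "\<dots> \<le> 2 * \<bar>u\<bar> powr (q - 1) * (B * (1 + L powr q))"
    by (intro mult_left_mono eta_moment i) auto
  finally show ?thesis .
qed

text \<open>Summing over i produces T under the expectation; replacing it by its mean costs the
  deviation term, and the n summand errors make up the other.\<close>

lemma stein_identity:
  "cmod (expectation (\<lambda>\<omega>. complex_of_real (Z \<omega>) * iexp (u * Z \<omega>))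
      - \<i> * u * s2 * expectation (\<lambda>\<omega>. iexp (u * Z \<omega>)))
    \<le> \<bar>u\<bar> * expectation (\<lambda>\<omega>. \<bar>T \<omega> - s2\<bar>) + 2 * \<bar>u\<bar> powr (q - 1) * (n * B * (1 + L powr q))"
proof -
  let ?a = "\<lambda>i. expectation (\<lambda>\<omega>. complex_of_real (X i \<omega>) * iexp (u * Z \<omega>))"
  let ?b = "\<lambda>i. expectation (\<lambda>\<omega>. complex_of_real (X i \<omega> * eta i \<omega>) * iexp (u * Z \<omega>))"
  let ?ET = "expectation (\<lambda>\<omega>. complex_of_real (T \<omega>) * iexp (u * Z \<omega>))"
  let ?psi = "expectation (\<lambda>\<omega>. iexp (u * Z \<omega>))"
  have EZ: "expectation (\<lambda>\<omega>. complex_of_real (Z \<omega>) * iexp (u * Z \<omega>)) = (\<Sum>i\<in>{1..n}. ?a i)"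
  proof -
    have "complex_of_real (Z \<omega>) * iexp (u * Z \<omega>) = (\<Sum>i\<in>{1..n}. complex_of_real (X i \<omega>) * iexp (u * Z \<omega>))" for \<omega>
      by (simp add: Z_def sum_distrib_right)
    moreover have "integrable M (\<lambda>\<omega>. complex_of_real (X i \<omega>) * iexp (u * Z \<omega>))" if "i \<in> {1..n}" for i
      using square_integrable_X[OF that] square_integrable_integrable
      by (intro integrable_mult_iexp) auto
    ultimately show ?thesis by (simp only:) (rule Bochner_Integration.integral_sum)
  qed
  have ET: "?ET = (\<Sum>i\<in>{1..n}. ?b i)"
  proof -
    have "complex_of_real (T \<omega>) * iexp (u * Z \<omega>) = (\<Sum>i\<in>{1..n}. complex_of_real (X i \<omega> * eta i \<omega>) * iexp (u * Z \<omega>))" for \<omega>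
      by (simp only: T_def sum_distrib_right of_real_sum)
    moreover have "integrable M (\<lambda>\<omega>. complex_of_real (X i \<omega> * eta i \<omega>) * iexp (u * Z \<omega>))" if "i \<in> {1..n}" for i
      using square_integrable_X[OF that] square_integrable_eta
      by (intro integrable_mult_iexp integrable_mult_square_integrable) auto
    ultimately show ?thesis by (simp only:) (rule Bochner_Integration.integral_sum)
  qed
  have intTs: "integrable M (\<lambda>\<omega>. T \<omega> - s2)" using integrable_T by simp
  have iT: "integrable M (\<lambda>\<omega>. complex_of_real (T \<omega>) * iexp (u * Z \<omega>))"
    by (rule integrable_mult_iexp[OF integrable_T]) simp
  have i1: "integrable M (\<lambda>\<omega>. iexp (u * Z \<omega>))"
    using integrable_mult_iexp[of "\<lambda>_. 1" "\<lambda>\<omega>. u * Z \<omega>"] by simp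
  have "?ET - s2 * ?psi = expectation (\<lambda>\<omega>. complex_of_real (T \<omega> - s2) * iexp (u * Z \<omega>))"
    using iT i1 by (simp add: left_diff_distrib)
  also have "cmod \<dots> \<le> expectation (\<lambda>\<omega>. cmod (complex_of_real (T \<omega> - s2) * iexp (u * Z \<omega>)))"
    by (rule integral_norm_bound)
  also have "\<dots> = expectation (\<lambda>\<omega>. \<bar>T \<omega> - s2\<bar>)"
    by (simp only: norm_mult norm_exp_i_times norm_of_real mult_1_right)
  finally have A: "cmod (?ET - s2 * ?psi) \<le> expectation (\<lambda>\<omega>. \<bar>T \<omega> - s2\<bar>)" .
  have A': "\<bar>u\<bar> * cmod (?ET - s2 * ?psi) \<le> \<bar>u\<bar> * expectation (\<lambda>\<omega>. \<bar>T \<omega> - s2\<bar>)"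
    by (rule mult_left_mono[OF A]) simp
  have b: "cmod (?a i - \<i> * u * ?b i) \<le> 2 * \<bar>u\<bar> powr (q - 1) * (B * (1 + L powr q))" if "i \<in> {1..n}" for i
    using stein_summand[OF that, of u] .
  have "(\<Sum>i\<in>{1..n}. cmod (?a i - \<i> * u * ?b i))
      \<le> real (card {1..n}) * (2 * \<bar>u\<bar> powr (q - 1) * (B * (1 + L powr q)))"
    using b by (rule sum_bounded_above)
  also have "\<dots> = 2 * \<bar>u\<bar> powr (q - 1) * (n * B * (1 + L powr q))"
    unfolding card_atLeastAtMost diff_Suc_1 by (simp only: mult_ac)
  finally have D: "(\<Sum>i\<in>{1..n}. cmod (?a i - \<i> * u * ?b i)) \<le> 2 * \<bar>u\<bar> powr (q - 1) * (n * B * (1 + L powr q))" .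
  have eq: "(\<Sum>i\<in>{1..n}. ?a i) - \<i> * u * s2 * ?psi = \<i> * u * (?ET - s2 * ?psi) + (\<Sum>i\<in>{1..n}. ?a i - \<i> * u * ?b i)"
    unfolding ET by (simp add: sum_subtractf sum_distrib_left right_diff_distrib mult_ac)
  have "cmod ((\<Sum>i\<in>{1..n}. ?a i) - \<i> * u * s2 * ?psi)
      \<le> \<bar>u\<bar> * cmod (?ET - s2 * ?psi) + (\<Sum>i\<in>{1..n}. cmod (?a i - \<i> * u * ?b i))"
    unfolding eq by (rule norm_triangle_mono) (auto simp: norm_mult intro: norm_sum)
  also have "\<dots> \<le> \<bar>u\<bar> * expectation (\<lambda>\<omega>. \<bar>T \<omega> - s2\<bar>) + 2 * \<bar>u\<bar> powr (q - 1) * (n * B * (1 + L powr q))"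
    using A' D by (rule add_mono)
  finally show ?thesis unfolding EZ .
qed

lemma T_deviation:
  assumes K: "0 < K"
  shows "expectation (\<lambda>\<omega>. \<bar>T \<omega> - s2\<bar>) \<le> L * K * sqrt (n * (6 * m + 1)) + 4 * n * L * B * K powr (1 - q / 2)"
proof -
  define P where "P = (SIGMA i:{1..n}. N i)"
  have finP: "finite P" by (auto simp: P_def)
  have "card P = (\<Sum>i\<in>{1..n}. card (N i))" by (simp add: P_def)
  also have "\<dots> \<le> (\<Sum>i\<in>{1..n}. 2 * m + 1)"
    unfolding N_def by (intro sum_mono card_near)
  finally have cardP: "card P \<le> n * (2 * m + 1)" by simp
  define Y where "Y = (\<lambda>(i, j) \<omega>. X i \<omega> * X j \<omega>)"
  have Pn: "i \<in> {1..n}" "j \<in> {1..n}" "near i j" if "(i, j) \<in> P" for i j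
    using that by (auto simp: P_def N_def)
  have Y_gs: "Y (i, j) \<in> borel_measurable (gs {i, j})" if "(i, j) \<in> P" for i j
    using Pn[OF that] X_gs measurable_gs_mono[of "{_}" "{i, j}"]
    unfolding Y_def prod.case by (intro borel_measurable_times) auto
  have YM: "Y a \<in> borel_measurable M" if "a \<in> P" for a
    using that X_measurable Pn by (cases a) (auto simp: Y_def)
  have intY: "integrable M (Y a)" if "a \<in> P" for a
    using that square_integrable_X Pn integrable_mult_square_integrable by (cases a) (auto simp: Y_def)
  define V where "V a \<omega> = clip K (Y a \<omega>)" for a \<omega>
  have VM: "V a \<in> borel_measurable M" if "a \<in> P" for a
    using YM[OF that] unfolding V_def by measurable
  have Vb: "\<bar>V a \<omega>\<bar> \<le> K" for a \<omega> using K by (simp add: V_def abs_clip_le)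
  have V2b: "(V a \<omega>)\<^sup>2 \<le> K\<^sup>2" for a \<omega> 
    using Vb[of a \<omega>] K abs_le_square_iff[of "V a \<omega>" K] by simp
  have V2: "square_integrable (V a)" if "a \<in> P" for a
    unfolding square_integrable_def using VM[OF that] V2b[of a]
    by (auto intro!: integrable_const_bound[of _ "K\<^sup>2"])
  have intV: "integrable M (V a)" if "a \<in> P" for a
    using V2[OF that] by (rule square_integrable_integrable)
  define C where "C a \<omega> = V a \<omega> - expectation (V a)" for a \<omega>
  have C2: "square_integrable (C a)" if "a \<in> P" for a
    unfolding C_def using V2[OF that] by (intro square_integrable_diff) (auto simp: square_integrable_def)
  have varC: "expectation (\<lambda>\<omega>. (C a \<omega>)\<^sup>2) \<le> K\<^sup>2" if "a \<in> P" for a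
  proof -
    have "expectation (\<lambda>\<omega>. (C a \<omega>)\<^sup>2) = expectation (\<lambda>\<omega>. (V a \<omega>)\<^sup>2) - (expectation (V a))\<^sup>2"
      unfolding C_def using intV[OF that] V2[OF that] by (intro variance_eq) (auto simp: square_integrable_def)
    also have "\<dots> \<le> expectation (\<lambda>\<omega>. (V a \<omega>)\<^sup>2)" by simp
    also have "\<dots> \<le> expectation (\<lambda>\<omega>. K\<^sup>2)"
      using V2[OF that] V2b by (intro integral_mono) (auto simp: square_integrable_def)
    finally show ?thesis by (simp add: prob_space)
  qed
  have EC: "expectation (C a) = 0" if "a \<in> P" for a
    unfolding C_def using intV[OF that] by (simp add: prob_space)
  have C_gs: "C (i, j) \<in> borel_measurable (gs {i, j})" if "(i, j) \<in> P" for i j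
    using Y_gs[OF that] unfolding C_def V_def by measurable
  \<comment> \<open>The members of a pair in P differ by at most m, so both indices of the first are
    at most i + m and both of the second at least k - m. A gap of more than 3m between i and k
    leaves more than m between the blocks.\<close>
  have orth: "expectation (\<lambda>\<omega>. C (i, j) \<omega> * C (k, l) \<omega>) = 0"
    if "(i, j) \<in> P" "(k, l) \<in> P" "i + 3 * m < k" for i j k l
  proof -
    have "indep_var borel (C (i, j)) borel (C (k, l))"
      by (rule indep_var_gs[OF _ _ indep_past_future C_gs[OF that(1)] C_gs[OF that(2)]])
         (use Pn[OF that(1)] Pn[OF that(2)] that(3) in \<open>auto simp: near_def\<close>)
    then have "expectation (\<lambda>\<omega>. C (i, j) \<omega> * C (k, l) \<omega>) = expectation (C (i, j)) * expectation (C (k, l))"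
      using C2 that square_integrable_integrable by (intro indep_var_lebesgue_integral) auto
    then show ?thesis using EC that by simp
  qed
  \<comment> \<open>At most 6m + 1 values of k lie within 3m of i, each with at most 2m + 1 near
    indices l.\<close>
  define R :: "nat \<times> nat \<Rightarrow> (nat \<times> nat) set"
    where "R = (\<lambda>(i, j). {(k, l). \<bar>int i - int k\<bar> \<le> 3 * int m \<and> near k l})"
  have "expectation (\<lambda>\<omega>. (\<Sum>a\<in>P. C a \<omega>)\<^sup>2) \<le> real (card P) * real ((6 * m + 1) * (2 * m + 1)) * K\<^sup>2"
  proof (rule expectation_square_sum_le[where R = R])
    fix a assume a: "a \<in> P"
    obtain i j where [simp]: "a = (i, j)" by (cases a)
    have "P \<inter> R a \<subseteq> (SIGMA k:{i - 3 * m..i + 3 * m}. N k)"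
      by (auto simp: P_def R_def)
    then have "card (P \<inter> R a) \<le> card (SIGMA k:{i - 3 * m..i + 3 * m}. N k)"
      by (intro card_mono) auto
    also have "\<dots> = (\<Sum>k\<in>{i - 3 * m..i + 3 * m}. card (N k))" by simp
    also have "\<dots> \<le> (\<Sum>k\<in>{i - 3 * m..i + 3 * m}. 2 * m + 1)"
      unfolding N_def by (intro sum_mono card_near)
    also have "\<dots> \<le> (6 * m + 1) * (2 * m + 1)"
      unfolding sum_constant by (intro mult_right_mono) auto
    finally show "card (P \<inter> R a) \<le> (6 * m + 1) * (2 * m + 1)" .
    fix b assume b: "b \<in> P" "b \<notin> R a"
    obtain k l where [simp]: "b = (k, l)" by (cases b)
    have "i + 3 * m < k \<or> k + 3 * m < i" using b Pn[of k l] by (auto simp: R_def)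
    then show "expectation (\<lambda>\<omega>. C a \<omega> * C b \<omega>) = 0"
      using orth[of i j k l] orth[of k l i j] a b by (auto simp: mult.commute)
  qed (use finP C2 varC in auto)
  also have "\<dots> \<le> real (n * (2 * m + 1)) * real ((6 * m + 1) * (2 * m + 1)) * K\<^sup>2"
    using cardP by (intro mult_right_mono) (simp_all only: of_nat_le_iff, auto)
  also have "\<dots> = (L * K)\<^sup>2 * (n * (6 * m + 1))"
    unfolding power2_eq_square of_nat_mult by (simp only: mult_ac)
  finally have "expectation (\<lambda>\<omega>. \<bar>\<Sum>a\<in>P. C a \<omega>\<bar>) \<le> sqrt ((L * K)\<^sup>2 * (n * (6 * m + 1)))"
    using C2 by (intro expectation_abs_le_sqrt square_integrable_sum) auto
  also have "\<dots> = L * K * sqrt (n * (6 * m + 1))"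
    using K by (simp only: real_sqrt_mult real_sqrt_abs) (simp add: abs_mult)
  finally have main: "expectation (\<lambda>\<omega>. \<bar>\<Sum>a\<in>P. C a \<omega>\<bar>) \<le> L * K * sqrt (n * (6 * m + 1))" .
  define D where "D a \<omega> = Y a \<omega> - V a \<omega>" for a \<omega>
  have intD: "integrable M (D a)" if "a \<in> P" for a
    unfolding D_def using intY[OF that] intV[OF that] by simp
  have ED: "expectation (\<lambda>\<omega>. \<bar>D a \<omega>\<bar>) \<le> 2 * B * K powr (1 - q / 2)" if a: "a \<in> P" for a
  proof -
    obtain i j where [simp]: "a = (i, j)" by (cases a)
    have ij: "i \<in> {1..n}" "j \<in> {1..n}" using Pn a by auto
    have pw: "\<bar>D a \<omega>\<bar> \<le> K powr (1 - q / 2) * (\<bar>X i \<omega>\<bar> powr q + \<bar>X j \<omega>\<bar> powr q)" for \<omega>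
    proof -
      have "\<bar>D a \<omega>\<bar> \<le> K powr (1 - q / 2) * \<bar>X i \<omega> * X j \<omega>\<bar> powr (q / 2)"
        unfolding D_def V_def Y_def using clip_error[OF K, of "q / 2"] q by simp
      also have "\<bar>X i \<omega> * X j \<omega>\<bar> powr (q / 2) = \<bar>X i \<omega>\<bar> powr (q / 2) * \<bar>X j \<omega>\<bar> powr (q / 2)"
        by (simp add: abs_mult powr_mult)
      also have "\<dots> \<le> \<bar>X i \<omega>\<bar> powr (q / 2 + q / 2) + \<bar>X j \<omega>\<bar> powr (q / 2 + q / 2)"
        using q by (intro mult_powr_le_sum_powr) auto
      \<comment> \<open>The two halves q/2 recombine to the available moment q; summing both moments
        gives the 2 B of \<open>ED\<close>.\<close>
      finally show ?thesis by (simp add: mult_left_mono)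
    qed
    have "expectation (\<lambda>\<omega>. \<bar>D a \<omega>\<bar>) \<le> expectation (\<lambda>\<omega>. K powr (1 - q / 2) * (\<bar>X i \<omega>\<bar> powr q + \<bar>X j \<omega>\<bar> powr q))"
      using intD[OF a] X_int[OF ij(1)] X_int[OF ij(2)] pw by (intro integral_mono) auto
    also have "\<dots> = K powr (1 - q / 2) * (expectation (\<lambda>\<omega>. \<bar>X i \<omega>\<bar> powr q) + expectation (\<lambda>\<omega>. \<bar>X j \<omega>\<bar> powr q))"
      using X_int[OF ij(1)] X_int[OF ij(2)] by simp
    also have "\<dots> \<le> K powr (1 - q / 2) * (B + B)"
      using X_le ij by (intro mult_left_mono add_mono) auto
    finally show ?thesis by (simp add: mult_ac)
  qed
  have TP: "T \<omega> = (\<Sum>a\<in>P. Y a \<omega>)" for \<omega>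
    unfolding T_def eta_def sum_distrib_left P_def Y_def
    by (subst sum.Sigma) (auto intro!: sum.cong)
  have "s2 = (\<Sum>a\<in>P. expectation (Y a))"
    unfolding expectation_T[symmetric] TP using intY by (intro Bochner_Integration.integral_sum) auto
  also have "\<dots> = (\<Sum>a\<in>P. expectation (V a) + expectation (D a))"
    unfolding D_def using intY intV by (intro sum.cong refl) simp
  \<comment> \<open>Both parts are centred separately: clipping shifts the mean, and the excess has
    to carry the compensating shift.\<close>
  finally have decomp: "T \<omega> - s2 = (\<Sum>a\<in>P. C a \<omega>) + (\<Sum>a\<in>P. D a \<omega> - expectation (D a))" for \<omega>
    by (simp add: TP C_def D_def sum_subtractf sum.distrib)
  have "expectation (\<lambda>\<omega>. \<bar>T \<omega> - s2\<bar>) \<le>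
      expectation (\<lambda>\<omega>. \<bar>\<Sum>a\<in>P. C a \<omega>\<bar> + (\<Sum>a\<in>P. \<bar>D a \<omega>\<bar> + expectation (\<lambda>\<omega>. \<bar>D a \<omega>\<bar>)))"
  proof (rule integral_mono)
    show "\<bar>T \<omega> - s2\<bar> \<le> \<bar>\<Sum>a\<in>P. C a \<omega>\<bar> + (\<Sum>a\<in>P. \<bar>D a \<omega>\<bar> + expectation (\<lambda>\<omega>. \<bar>D a \<omega>\<bar>))" for \<omega>
      unfolding decomp
    proof (rule order_trans[OF abs_triangle_ineq add_left_mono])
      have "\<bar>D a \<omega> - expectation (D a)\<bar> \<le> \<bar>D a \<omega>\<bar> + expectation (\<lambda>\<omega>. \<bar>D a \<omega>\<bar>)" for a
        using integral_abs_bound[of M "D a"] by linarith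
      then show "\<bar>\<Sum>a\<in>P. D a \<omega> - expectation (D a)\<bar> \<le> (\<Sum>a\<in>P. \<bar>D a \<omega>\<bar> + expectation (\<lambda>\<omega>. \<bar>D a \<omega>\<bar>))"
        by (intro order_trans[OF sum_abs] sum_mono)
    qed
    show "integrable M (\<lambda>\<omega>. \<bar>T \<omega> - s2\<bar>)" using integrable_T by simp
    show "integrable M (\<lambda>\<omega>. \<bar>\<Sum>a\<in>P. C a \<omega>\<bar> + (\<Sum>a\<in>P. \<bar>D a \<omega>\<bar> + expectation (\<lambda>\<omega>. \<bar>D a \<omega>\<bar>)))"
      using intD C2 square_integrable_integrable
      by (intro Bochner_Integration.integrable_add integrable_abs Bochner_Integration.integrable_sum) auto
  qed
  also have "\<dots> = expectation (\<lambda>\<omega>. \<bar>\<Sum>a\<in>P. C a \<omega>\<bar>) + (\<Sum>a\<in>P. 2 * expectation (\<lambda>\<omega>. \<bar>D a \<omega>\<bar>))"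
    using intD C2 square_integrable_integrable
    by (subst Bochner_Integration.integral_add, force, force, subst Bochner_Integration.integral_sum)
       (auto simp: prob_space)
  also have "\<dots> \<le> L * K * sqrt (n * (6 * m + 1)) + real (card P) * (2 * (2 * B * K powr (1 - q / 2)))"
    by (intro add_mono main sum_bounded_above mult_left_mono ED) auto
  also have "\<dots> \<le> L * K * sqrt (n * (6 * m + 1)) + real (n * (2 * m + 1)) * (2 * (2 * B * K powr (1 - q / 2)))"
    using cardP B_nonneg by (intro add_left_mono mult_right_mono) (simp_all only: of_nat_le_iff, auto)
  \<comment> \<open>The 4 is 2 B per excess, taken twice because of the centring of D.\<close>
  also have "real (n * (2 * m + 1)) * (2 * (2 * B * K powr (1 - q / 2))) = 4 * n * L * B * K powr (1 - q / 2)"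
    unfolding of_nat_mult by simp
  finally show ?thesis .
qed

text \<open>exp(s2 v^2 / 2) is the integrating factor of the approximate differential equation: the
  derivative of its product with the characteristic function is the Stein error times that factor.
  The mean value inequality from 0, where the product equals 1, does the rest.\<close>

lemma char_sum_approx:
  assumes K: "0 < K"
  shows "cmod (expectation (\<lambda>\<omega>. iexp (u * Z \<omega>)) * exp (s2 * u\<^sup>2 / 2) - 1)
    \<le> exp (s2 * u\<^sup>2 / 2) * (u\<^sup>2 * (L * K * sqrt (n * (6 * m + 1)) + 4 * n * L * B * K powr (1 - q / 2))
        + 2 * \<bar>u\<bar> powr q * (n * B * (1 + L powr q)))"
proof -
  let ?A = "L * K * sqrt (n * (6 * m + 1)) + 4 * n * L * B * K powr (1 - q / 2)"
  let ?D = "n * B * (1 + L powr q)"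
  let ?psi = "\<lambda>v. expectation (\<lambda>\<omega>. iexp (v * Z \<omega>))"
  let ?EZ = "\<lambda>v. expectation (\<lambda>\<omega>. complex_of_real (Z \<omega>) * iexp (v * Z \<omega>))"
  let ?e = "\<lambda>v. complex_of_real (exp (s2 * v\<^sup>2 / 2))"
  let ?f = "\<lambda>v. ?psi v * ?e v"
  let ?f' = "\<lambda>v. \<i> * (?EZ v - \<i> * v * s2 * ?psi v) * ?e v"
  define Bd where "Bd = exp (s2 * u\<^sup>2 / 2) * (\<bar>u\<bar> * ?A + 2 * \<bar>u\<bar> powr (q - 1) * ?D)"
  have s2: "0 \<le> s2" by (simp add: s2_def)
  have D0: "0 \<le> ?D" using B_nonneg by simp
  have A0: "0 \<le> ?A" using B_nonneg K by simp
  have der: "(?f has_vector_derivative ?f' v) (at v)" for v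
  proof -
    have "((\<lambda>v. exp (s2 * v\<^sup>2 / 2)) has_real_derivative (exp (s2 * v\<^sup>2 / 2) * (s2 * v))) (at v)"
      by (auto intro!: derivative_eq_intros)
    then have "(?e has_vector_derivative complex_of_real (exp (s2 * v\<^sup>2 / 2) * (s2 * v))) (at v)"
      by (rule has_vector_derivative_of_real)
    from has_vector_derivative_mult[OF char_has_vector_derivative[OF square_integrable_Z] this]
    show ?thesis
      by (rule back_subst[of "\<lambda>d. (?f has_vector_derivative d) (at v)"]) (simp add: algebra_simps)
  qed
  have bound: "cmod (?f' v) \<le> Bd" if v: "\<bar>v\<bar> \<le> \<bar>u\<bar>" for v
  proof -
    have "cmod (?f' v) = cmod (?EZ v - \<i> * v * s2 * ?psi v) * exp (s2 * v\<^sup>2 / 2)"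
      by (simp add: norm_mult)
    also have "\<dots> \<le> (\<bar>u\<bar> * ?A + 2 * \<bar>u\<bar> powr (q - 1) * ?D) * exp (s2 * u\<^sup>2 / 2)"
    proof (intro mult_mono)
      have "cmod (?EZ v - \<i> * v * s2 * ?psi v) \<le> \<bar>v\<bar> * expectation (\<lambda>\<omega>. \<bar>T \<omega> - s2\<bar>) + 2 * \<bar>v\<bar> powr (q - 1) * ?D"
        by (rule stein_identity)
      also have "\<dots> \<le> \<bar>u\<bar> * ?A + 2 * \<bar>u\<bar> powr (q - 1) * ?D"
        using v q D0 by (intro add_mono mult_mono mult_right_mono T_deviation[OF K] powr_mono2) auto
      finally show "cmod (?EZ v - \<i> * v * s2 * ?psi v) \<le> \<bar>u\<bar> * ?A + 2 * \<bar>u\<bar> powr (q - 1) * ?D" .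
      have "v\<^sup>2 \<le> u\<^sup>2" using v by (simp add: abs_le_square_iff)
      then show "exp (s2 * v\<^sup>2 / 2) \<le> exp (s2 * u\<^sup>2 / 2)"
        using s2 by (simp add: mult_left_mono)
    qed (use A0 D0 in auto)
    finally show ?thesis by (simp add: Bd_def mult.commute)
  qed
  have "norm (?f u - ?f 0) \<le> Bd * norm (u - 0)"
  proof (rule differentiable_bound)
    \<comment> \<open>The symmetric interval contains 0 and u whatever the sign of u, and the
      derivative bound holds on all of it.\<close>
    let ?S = "{-\<bar>u\<bar>..\<bar>u\<bar>}"
    show "(?f has_derivative (\<lambda>h. h *\<^sub>R ?f' v)) (at v within ?S)" for v
      using has_vector_derivative_at_within[OF der, of v ?S] by (simp only: has_vector_derivative_def)
    show "onorm (\<lambda>h. h *\<^sub>R ?f' v) \<le> Bd" if "v \<in> ?S" for v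
    proof (rule onorm_le)
      fix h :: real
      have "cmod (?f' v) \<le> Bd" using that by (intro bound) auto
      then show "norm (h *\<^sub>R ?f' v) \<le> Bd * norm h"
        unfolding norm_scaleR by (simp add: mult.commute[of Bd] mult_left_mono)
    qed
  qed auto
  also have "?f 0 = 1" by (simp add: prob_space)
  also have "Bd * norm (u - 0) = exp (s2 * u\<^sup>2 / 2) * (u\<^sup>2 * ?A + 2 * \<bar>u\<bar> powr q * ?D)"
  proof -
    have 1: "\<bar>u\<bar> * \<bar>u\<bar> = u\<^sup>2" by (simp add: power2_eq_square)
    have 2: "\<bar>u\<bar> powr (q - 1) * \<bar>u\<bar> = \<bar>u\<bar> powr q"
      using powr_add[of "\<bar>u\<bar>" "q - 1" 1] by simp
    have "Bd * norm (u - 0) = exp (s2 * u\<^sup>2 / 2) * ((\<bar>u\<bar> * \<bar>u\<bar>) * ?A + 2 * (\<bar>u\<bar> powr (q - 1) * \<bar>u\<bar>) * ?D)"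
      unfolding Bd_def by (simp add: distrib_left distrib_right mult_ac)
    then show ?thesis unfolding 1 2 .
  qed
  finally show ?thesis by (simp del: of_real_exp)
qed

end

section \<open>From L1 bounds to characteristic functions and stochastic orders\<close>

context prob_space
begin

text \<open>The exponential is Lipschitz with constant |t|, so an L1-small perturbation does not
  affect the limit law; this takes the place of Slutsky's theorem.\<close>

lemma expectation_iexp_diff_le:
  assumes [measurable]: "X \<in> borel_measurable M" "Y \<in> borel_measurable M" 
    and int: "integrable M (\<lambda>\<omega>. X \<omega> - Y \<omega>)"
  shows "cmod (expectation (\<lambda>\<omega>. iexp (t * X \<omega>)) - expectation (\<lambda>\<omega>. iexp (t * Y \<omega>)))
    \<le> \<bar>t\<bar> * expectation (\<lambda>\<omega>. \<bar>X \<omega> - Y \<omega>\<bar>)"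
proof -
  have i: "integrable M (\<lambda>\<omega>. iexp (t * Z \<omega>))" if "Z \<in> borel_measurable M" for Z
    using that integrable_mult_iexp[of "\<lambda>_. 1" "\<lambda>\<omega>. t * Z \<omega>"] by simp
  have pw: "cmod (iexp (t * X \<omega>) - iexp (t * Y \<omega>)) \<le> \<bar>t\<bar> * \<bar>X \<omega> - Y \<omega>\<bar>" for \<omega>
  proof -
    have "iexp (t * X \<omega>) - iexp (t * Y \<omega>) = iexp (t * Y \<omega>) * (iexp (t * (X \<omega> - Y \<omega>)) - 1)"
      by (simp add: algebra_simps exp_add[symmetric])
    then have "cmod (iexp (t * X \<omega>) - iexp (t * Y \<omega>)) = cmod (iexp (t * (X \<omega> - Y \<omega>)) - 1)"
      by (simp only: norm_mult norm_exp_i_times mult_1_left)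
    also have "\<dots> \<le> \<bar>t * (X \<omega> - Y \<omega>)\<bar>"
      using iexp_approx1[of "t * (X \<omega> - Y \<omega>)" 0] by simp
    finally show ?thesis by (simp add: abs_mult)
  qed
  have "expectation (\<lambda>\<omega>. iexp (t * X \<omega>)) - expectation (\<lambda>\<omega>. iexp (t * Y \<omega>)) =
      expectation (\<lambda>\<omega>. iexp (t * X \<omega>) - iexp (t * Y \<omega>))"
    using i[of X] i[of Y] by simp
  then have "cmod (expectation (\<lambda>\<omega>. iexp (t * X \<omega>)) - expectation (\<lambda>\<omega>. iexp (t * Y \<omega>)))
      \<le> expectation (\<lambda>\<omega>. cmod (iexp (t * X \<omega>) - iexp (t * Y \<omega>)))"
    by (simp only: integral_norm_bound)
  also have "\<dots> \<le> expectation (\<lambda>\<omega>. \<bar>t\<bar> * \<bar>X \<omega> - Y \<omega>\<bar>)"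
    using i[of X] i[of Y] int pw by (intro integral_mono) auto
  finally show ?thesis by simp
qed

lemma markov_abs:
  assumes X: "integrable M X" "expectation (\<lambda>\<omega>. \<bar>X \<omega>\<bar>) \<le> B" and c: "0 < c"
  shows "prob {\<omega> \<in> space M. \<bar>X \<omega>\<bar> > c} \<le> B / c"
proof -
  have [measurable]: "X \<in> borel_measurable M" using X by simp
  have "prob {\<omega> \<in> space M. \<bar>X \<omega>\<bar> > c} \<le> prob {\<omega> \<in> space M. \<bar>X \<omega>\<bar> \<ge> c}"
    by (intro finite_measure_mono) auto
  also have "\<dots> \<le> expectation (\<lambda>\<omega>. \<bar>X \<omega>\<bar>) / c"
    by (rule integral_Markov_inequality_measure[where A = "{}"]) (use X c in auto)
  also have "\<dots> \<le> B / c" using X c by (intro divide_right_mono) auto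
  finally show ?thesis .
qed

lemma big_O_prob_of_L1:
  assumes X: "\<And>n. X n \<in> borel_measurable M"
    and K: "0 \<le> K" and a: "\<forall>\<^sub>F n in sequentially. 0 < a n"
    and L1: "\<forall>\<^sub>F n in sequentially. integrable M (X n) \<and> expectation (\<lambda>\<omega>. \<bar>X n \<omega>\<bar>) \<le> K * a n"
  shows "big_O_prob M X a"
  unfolding big_O_prob_def
proof (intro conjI allI impI)
  fix \<epsilon> :: real assume \<epsilon>: "0 < \<epsilon>"
  \<comment> \<open>K / epsilon is what Markov's inequality asks for; the added 1 keeps C positive
    when K = 0.\<close>
  define C where "C = K / \<epsilon> + 1"
  have C: "0 < C" using K \<epsilon> by (simp add: C_def add_nonneg_pos)
  have "\<forall>\<^sub>F n in sequentially. prob {\<omega> \<in> space M. \<bar>X n \<omega>\<bar> > C * a n} \<le> \<epsilon>"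
    using a L1
  proof eventually_elim
    case (elim n)
    then have "prob {\<omega> \<in> space M. \<bar>X n \<omega>\<bar> > C * a n} \<le> K * a n / (C * a n)"
      using C by (intro markov_abs) auto
    also have "\<dots> = K / C" using elim by simp
    also have "\<dots> \<le> \<epsilon>" using C \<epsilon> K by (simp add: C_def field_simps)
    finally show ?case .
  qed
  then show "\<exists>C>0. \<forall>\<^sub>F n in sequentially. prob {\<omega> \<in> space M. \<bar>X n \<omega>\<bar> > C * a n} \<le> \<epsilon>"
    using C by blast
qed (rule X)

lemma small_o_prob_of_L1:
  assumes X: "\<And>n. X n \<in> borel_measurable M"
    and L1: "\<forall>\<^sub>F n in sequentially. integrable M (X n) \<and> expectation (\<lambda>\<omega>. \<bar>X n \<omega>\<bar>) \<le> b n"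
    and b: "b \<longlonglongrightarrow> 0"
  shows "small_o_prob M X (\<lambda>_. 1)"
  unfolding small_o_prob_def
proof (intro conjI allI impI)
  fix \<epsilon> :: real assume \<epsilon>: "0 < \<epsilon>"
  show "(\<lambda>n. prob {\<omega> \<in> space M. \<bar>X n \<omega>\<bar> > \<epsilon> * 1}) \<longlonglongrightarrow> 0"
  proof (rule tendsto_sandwich[of "\<lambda>_. 0"])
    show "\<forall>\<^sub>F n in sequentially. prob {\<omega> \<in> space M. \<bar>X n \<omega>\<bar> > \<epsilon> * 1} \<le> b n / \<epsilon>"
      using L1 by eventually_elim (use \<epsilon> in \<open>auto intro!: markov_abs\<close>)
    show "(\<lambda>n. b n / \<epsilon>) \<longlonglongrightarrow> 0" using tendsto_divide[OF b tendsto_const[of \<epsilon>]] \<epsilon> by simp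
  qed auto
qed (rule X)

end

text \<open>Normalisation makes s2 u^2 = t^2, so the exponential factors cancel, and the linear
  lower bound on s2 turns every error term into a power of n that is negative for q > 2.\<close>

lemma (in m_dependent_row) char_normalized_sum:
  fixes c t :: real
  assumes c: "0 < c" and n: "1 \<le> n" and s2: "c * real n \<le> s2"
  shows "cmod (expectation (\<lambda>\<omega>. iexp (t * (Z \<omega> / sqrt s2))) - complex_of_real (exp (- (t\<^sup>2) / 2))) \<le>
    t\<^sup>2 / c * L * sqrt (6 * m + 1) * n powr (- (1 / 4)) + 4 * t\<^sup>2 * L * B / c * n powr ((1 - q / 2) / 4)
    + 2 * \<bar>t\<bar> powr q * c powr (- (q / 2)) * B * (1 + L powr q) * n powr (1 - q / 2)"
proof -
  let ?n = "real n"
  define u where "u = t / sqrt s2"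
  \<comment> \<open>K must tend to infinity for the excess to vanish, but more slowly than sqrt n
    for the clipped part; any power strictly between 0 and 1/2 would do.\<close>
  define K where "K = ?n powr (1 / 4)"
  have n0: "0 < ?n" using n by simp
  have cn: "0 < c * ?n" using c n0 by simp
  then have s0: "0 < s2" using s2 by linarith
  have u2: "s2 * u\<^sup>2 = t\<^sup>2" using s0 by (simp add: u_def power_divide)
  have K: "0 < K" using n0 by (simp add: K_def)
  let ?A = "L * K * sqrt (n * (6 * m + 1)) + 4 * n * L * B * K powr (1 - q / 2)"
  let ?D = "n * B * (1 + L powr q)"
  let ?psi = "expectation (\<lambda>\<omega>. iexp (u * Z \<omega>))"
  have A0: "0 \<le> ?A" using K B_nonneg by simp
  have D0: "0 \<le> ?D" using B_nonneg by simp
  have e: "exp (- (t\<^sup>2) / 2) * exp (t\<^sup>2 / 2) = 1" by (simp add: exp_add[symmetric])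
  then have e': "complex_of_real (exp (t\<^sup>2 / 2)) * complex_of_real (exp (- (t\<^sup>2) / 2)) = 1"
    by (metis mult.commute of_real_1 of_real_mult)
  have "?psi - complex_of_real (exp (- (t\<^sup>2) / 2)) =
      (?psi * complex_of_real (exp (s2 * u\<^sup>2 / 2)) - 1) * complex_of_real (exp (- (t\<^sup>2) / 2))"
    unfolding u2 left_diff_distrib mult.assoc e' by simp
  then have "cmod (?psi - complex_of_real (exp (- (t\<^sup>2) / 2))) =
      cmod (?psi * complex_of_real (exp (s2 * u\<^sup>2 / 2)) - 1) * exp (- (t\<^sup>2) / 2)"
    by (simp only: norm_mult norm_of_real abs_exp_cancel)
  also have "\<dots> \<le> (exp (s2 * u\<^sup>2 / 2) * (u\<^sup>2 * ?A + 2 * \<bar>u\<bar> powr q * ?D)) * exp (- (t\<^sup>2) / 2)"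
    by (rule mult_right_mono[OF char_sum_approx[OF K]]) simp
  also have "\<dots> = (exp (- (t\<^sup>2) / 2) * exp (t\<^sup>2 / 2)) * (u\<^sup>2 * ?A + 2 * \<bar>u\<bar> powr q * ?D)"
    unfolding u2 by (simp only: mult_ac)
  also have "\<dots> = u\<^sup>2 * ?A + 2 * \<bar>u\<bar> powr q * ?D" unfolding e by simp
  also have "\<dots> \<le> t\<^sup>2 / (c * ?n) * ?A + 2 * (\<bar>t\<bar> powr q * (c * ?n) powr (- (q / 2))) * ?D"
  proof (intro add_mono mult_right_mono mult_left_mono A0 D0)
    have "u\<^sup>2 = t\<^sup>2 / s2" using s0 by (simp add: u_def power_divide)
    also have "\<dots> \<le> t\<^sup>2 / (c * ?n)" using s2 cn by (intro divide_left_mono) auto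
    finally show "u\<^sup>2 \<le> t\<^sup>2 / (c * ?n)" .
    have half: "sqrt s2 = s2 powr (1 / 2)" using s0 by (simp add: powr_half_sqrt)
    have "sqrt s2 powr q = s2 powr (q / 2)" unfolding half powr_powr by simp
    moreover have "\<bar>u\<bar> powr q = \<bar>t\<bar> powr q / sqrt s2 powr q"
      using s0 by (simp add: u_def powr_divide)
    ultimately have "\<bar>u\<bar> powr q = \<bar>t\<bar> powr q * s2 powr (- (q / 2))"
      by (simp add: powr_minus_divide)
    moreover have "s2 powr (- (q / 2)) \<le> (c * ?n) powr (- (q / 2))"
      by (rule powr_mono2'[OF _ cn s2]) (use q in simp)
    ultimately show "\<bar>u\<bar> powr q \<le> \<bar>t\<bar> powr q * (c * ?n) powr (- (q / 2))"
      by (simp add: mult_left_mono)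
  qed simp
  also have "t\<^sup>2 / (c * ?n) * ?A = t\<^sup>2 / c * L * sqrt (6 * m + 1) * (K * sqrt ?n / ?n) + 4 * t\<^sup>2 * L * B / c * K powr (1 - q / 2)"
    unfolding of_nat_mult real_sqrt_mult using c n0 by (simp add: field_simps)
  also have "K * sqrt ?n / ?n = ?n powr (- (1 / 4))"
  proof -
    have "K * sqrt ?n / ?n = ?n powr (1 / 4) * ?n powr (1 / 2) * ?n powr (- 1)"
      using n0 by (simp add: K_def powr_half_sqrt powr_minus_divide)
    then show ?thesis unfolding powr_add[symmetric] by simp
  qed
  also have "K powr (1 - q / 2) = ?n powr ((1 - q / 2) / 4)"
    by (simp add: K_def powr_powr)
  also have "2 * (\<bar>t\<bar> powr q * (c * ?n) powr (- (q / 2))) * ?D =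
      2 * \<bar>t\<bar> powr q * c powr (- (q / 2)) * B * (1 + L powr q) * (?n powr (- (q / 2)) * ?n)"
    using c n0 unfolding powr_mult by (simp only: mult_ac)
  also have "?n powr (- (q / 2)) * ?n = ?n powr (1 - q / 2)"
    using n0 powr_add[of ?n "- (q / 2)" 1] by simp
  finally show ?thesis by (simp add: u_def)
qed

text \<open>One q, one B and one c serve all rows; the rows are centred, so v is the variance of the
  row sum.\<close>

theorem (in m_dependent_sequence) m_dependent_CLT:
  fixes X :: "nat \<Rightarrow> nat \<Rightarrow> 'a \<Rightarrow> real"
  defines "v \<equiv> \<lambda>n. expectation (\<lambda>\<omega>. (\<Sum>i\<in>{1..n}. X n i \<omega>)\<^sup>2)"
  assumes row: "\<And>n. m_dependent_row M S W m (X n) n q B"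
    and c: "0 < c" and v: "\<forall>\<^sub>F n in sequentially. c * real n \<le> v n"
  shows "(\<lambda>n. expectation (\<lambda>\<omega>. iexp (t * ((\<Sum>i\<in>{1..n}. X n i \<omega>) / sqrt (v n)))))
    \<longlonglongrightarrow> complex_of_real (exp (- (t\<^sup>2) / 2))"
proof (rule LIM_zero_cancel, rule tendsto_norm_zero_cancel, rule tendsto_sandwich[of "\<lambda>_. 0"])
  \<comment> \<open>Any single row will do here: it only supplies q > 2, the row parameter q being
    common to all.\<close>
  interpret r0: m_dependent_row M S W m "X 0" 0 q B by (rule row)
  let ?L = "real (2 * m + 1)"
  define C1 C2 C3 where "C1 = t\<^sup>2 / c * ?L * sqrt (6 * m + 1)" and "C2 = 4 * t\<^sup>2 * ?L * B / c"
    and "C3 = 2 * \<bar>t\<bar> powr q * c powr (- (q / 2)) * B * (1 + ?L powr q)"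
  let ?b = "\<lambda>n. C1 * n powr (- (1 / 4)) + C2 * n powr ((1 - q / 2) / 4) + C3 * n powr (1 - q / 2)"
  show "\<forall>\<^sub>F n in sequentially. norm (expectation (\<lambda>\<omega>. iexp (t * ((\<Sum>i\<in>{1..n}. X n i \<omega>) / sqrt (v n))))
      - complex_of_real (exp (- (t\<^sup>2) / 2))) \<le> ?b (real n)"
    using v eventually_ge_at_top[of 1]
  proof eventually_elim
    case (elim n)
    interpret m_dependent_row M S W m "X n" n q B by (rule row)
    have "s2 = v n" by (simp add: s2_def v_def Z_def)
    then show ?case
      using char_normalized_sum[OF c, of t] elim unfolding Z_def C1_def C2_def C3_def by simp
  qed
  have "q > 2" by (rule r0.q)
  then have "(\<lambda>n. real n powr (1 - q / 2)) \<longlonglongrightarrow> 0" "(\<lambda>n. real n powr ((1 - q / 2) / 4)) \<longlonglongrightarrow> 0"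
    "(\<lambda>n. real n powr (- (1 / 4))) \<longlonglongrightarrow> 0"
    by (auto intro!: tendsto_neg_powr filterlim_real_sequentially)
  from tendsto_add[OF tendsto_add[OF tendsto_mult_left[OF this(3), of C1] tendsto_mult_left[OF this(2), of C2]]
      tendsto_mult_left[OF this(1), of C3]]
  show "(\<lambda>n. ?b (real n)) \<longlonglongrightarrow> 0" by simp
qed auto

section \<open>Limit theorems for the U-statistic\<close>

context m_dependent_kernel
begin

text \<open>The projection sum has second moment of order n, hence contributes order 1 / sqrt n; the
  remainder, of order 1 / n, is absorbed in it.\<close>

lemma U_stat_L1:
  assumes n: "2 \<le> n"
  shows "integrable M (U_stat W \<phi> n)"
    "expectation (\<lambda>\<omega>. \<bar>U_stat W \<phi> n \<omega>\<bar>) \<le> (18 * real (2 * m + 1) * sqrt B2 + 2 * sqrt (real (2 * m + 1) * B2)) * sqrt ((real m + 1) / n)"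
proof -
  let ?L = "real (2 * m + 1)"
  define R where "R \<omega> = U_stat W \<phi> n \<omega> - 2 / n * (\<Sum>i\<in>{1..n}. avg n i \<omega>)" for \<omega>
  define P where "P \<omega> = (\<Sum>i\<in>{1..n}. avg n i \<omega>)" for \<omega>
  note R = remainder_L1[OF n, folded R_def]
  have sqP: "square_integrable P" unfolding P_def
    using square_integrable_avg(1) by (auto intro!: square_integrable_sum)
  have intP: "integrable M P" using sqP by (rule square_integrable_integrable)
  have U: "U_stat W \<phi> n \<omega> = R \<omega> + 2 / n * P \<omega>" for \<omega> by (simp add: R_def P_def)
  have "integrable M (\<lambda>\<omega>. R \<omega> + 2 / n * P \<omega>)" using R(1) intP by simp
  then show intU: "integrable M (U_stat W \<phi> n)" by (simp add: U[abs_def])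
  have P: "expectation (\<lambda>\<omega>. \<bar>P \<omega>\<bar>) \<le> sqrt (n * ?L * B2)"
    using sqP sum_avg_square[of n] unfolding P_def by (rule expectation_abs_le_sqrt)
  have rate: "18 * ?L * sqrt B2 / n \<le> 18 * ?L * sqrt B2 * (1 / sqrt n)"
  proof -
    have "sqrt n * 1 \<le> sqrt n * sqrt n" using n by (intro mult_left_mono) auto
    then have "1 / n \<le> 1 / sqrt n" using n by (intro divide_left_mono) auto
    then show ?thesis using mult_left_mono[of "1 / n" "1 / sqrt n" "18 * ?L * sqrt B2"] B2_nonneg by simp
  qed
  have "expectation (\<lambda>\<omega>. \<bar>U_stat W \<phi> n \<omega>\<bar>) \<le> expectation (\<lambda>\<omega>. \<bar>R \<omega>\<bar> + 2 / n * \<bar>P \<omega>\<bar>)"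
  proof (rule integral_mono)
    show "\<bar>U_stat W \<phi> n \<omega>\<bar> \<le> \<bar>R \<omega>\<bar> + 2 / n * \<bar>P \<omega>\<bar>" for \<omega>
      unfolding U using abs_triangle_ineq[of "R \<omega>" "2 / n * P \<omega>"] by (simp add: abs_mult)
  qed (use intU R(1) intP in auto)
  also have "\<dots> = expectation (\<lambda>\<omega>. \<bar>R \<omega>\<bar>) + 2 / n * expectation (\<lambda>\<omega>. \<bar>P \<omega>\<bar>)"
    using R(1) intP by simp
  also have "\<dots> \<le> 18 * ?L * sqrt B2 / n + 2 / n * sqrt (n * ?L * B2)"
    by (intro add_mono mult_left_mono R(2) P) auto
  also have "2 / n * sqrt (n * ?L * B2) = 2 * sqrt (?L * B2) * (sqrt n / n)"
    unfolding mult.assoc[of "real n"] real_sqrt_mult[of "real n"] by simp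
  also have "sqrt n / n = 1 / sqrt n" by (simp add: sqrt_divide_self_eq inverse_eq_divide)
  also have "18 * ?L * sqrt B2 / n + 2 * sqrt (?L * B2) * (1 / sqrt n)
      \<le> 18 * ?L * sqrt B2 * (1 / sqrt n) + 2 * sqrt (?L * B2) * (1 / sqrt n)"
    by (rule add_right_mono[OF rate])
  also have "18 * ?L * sqrt B2 * (1 / sqrt n) + 2 * sqrt (?L * B2) * (1 / sqrt n) =
      (18 * ?L * sqrt B2 + 2 * sqrt (?L * B2)) * sqrt (1 / n)"
    unfolding real_sqrt_divide real_sqrt_one by (simp only: distrib_right)
  also have "\<dots> \<le> (18 * ?L * sqrt B2 + 2 * sqrt (?L * B2)) * sqrt ((real m + 1) / n)"
    using B2_nonneg by (intro mult_left_mono real_sqrt_le_mono divide_right_mono) auto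
  finally show "expectation (\<lambda>\<omega>. \<bar>U_stat W \<phi> n \<omega>\<bar>) \<le> 
      (18 * ?L * sqrt B2 + 2 * sqrt (?L * B2)) * sqrt ((real m + 1) / n)" .
qed

text \<open>The averaged projections are centred, so this variance is the second moment by which
  \<open>m_dependent_CLT\<close> normalises.\<close>

lemma proj_sd_eq:
  "proj_sd M S W \<phi> n m = sqrt (4 / real n * expectation (\<lambda>\<omega>. (\<Sum>i\<in>{1..n}. avg n i \<omega>)\<^sup>2))"
proof -
  have "expectation (\<lambda>\<omega>. \<Sum>i\<in>{1..n}. avg n i \<omega>) = (\<Sum>i\<in>{1..n}. expectation (avg n i))"
    using square_integrable_avg(1) square_integrable_integrable
    by (intro Bochner_Integration.integral_sum) auto
  then show ?thesis using expectation_avg by (simp add: proj_sd_def)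
qed

text \<open>After normalisation the projection part is exactly the standardised row sum P. What
  remains is the L1 remainder of order 1 / n times a factor of order at most sqrt n, hence
  negligible in characteristic functions.\<close>

lemma asymptotic_normality:
  assumes q: "2 < q" "q \<le> 3" and B: "0 \<le> B"
    and int: "\<And>i j. 1 \<le> i \<Longrightarrow> 1 \<le> j \<Longrightarrow> integrable M (\<lambda>\<omega>. \<bar>h i j \<omega>\<bar> powr q)"
    and le: "\<And>i j. 1 \<le> i \<Longrightarrow> 1 \<le> j \<Longrightarrow> expectation (\<lambda>\<omega>. \<bar>h i j \<omega>\<bar> powr q) \<le> B"
    and lam: "0 < lam" "\<forall>\<^sub>F n in sequentially. (proj_sd M S W \<phi> n m)\<^sup>2 \<ge> lam"
  shows "weak_conv_m
    (\<lambda>n. distr M borel (\<lambda>\<omega>. inverse (proj_sd M S W \<phi> n m) * sqrt (real n) * U_stat W \<phi> n \<omega>))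
    std_normal_distribution"
proof (rule levy_continuity)
  note [measurable] = U_stat_measurable avg_measurable
  define v where "v n = expectation (\<lambda>\<omega>. (\<Sum>i\<in>{1..n}. avg n i \<omega>)\<^sup>2)" for n
  define P where "P n \<omega> = (\<Sum>i\<in>{1..n}. avg n i \<omega>) / sqrt (v n)" for n \<omega>
  define G where "G n \<omega> = inverse (proj_sd M S W \<phi> n m) * sqrt (real n) * U_stat W \<phi> n \<omega>" for n \<omega>
  define K where "K = 18 * real (2 * m + 1) * sqrt B2"
  have GM [measurable]: "G n \<in> borel_measurable M" for n unfolding G_def by measurable
  have PM: "P n \<in> borel_measurable M" for n unfolding P_def using avg_measurable by auto
  have sd: "proj_sd M S W \<phi> n m = sqrt (4 / real n * v n)" for n by (simp add: proj_sd_eq v_def)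
  have v0: "0 \<le> v n" for n by (simp add: v_def)
  \<comment> \<open>Demanded for every n, also for the finitely many at which \<open>proj_sd\<close>
    may be 0 and \<open>inverse\<close> returns 0.\<close>
  show "real_distribution (distr M borel (\<lambda>\<omega>. inverse (proj_sd M S W \<phi> n m) * sqrt (real n) * U_stat W \<phi> n \<omega>))" for n
    by (rule real_distribution_distr) measurable
  show "real_distribution std_normal_distribution" by (rule real_dist_normal_dist)
  have row: "m_dependent_row M S W m (avg n) n q B" for n
  proof unfold_locales
    fix i assume "i \<in> {1..n}"
    then have i: "1 \<le> i" by simp
    show "avg n i \<in> borel_measurable (gs {i})" by (rule avg_measurable_gs) simp
    show "integrable M (\<lambda>\<omega>. \<bar>avg n i \<omega>\<bar> powr q)" "expectation (\<lambda>\<omega>. \<bar>avg n i \<omega>\<bar> powr q) \<le> B"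
      using avg_powr_moment[OF i _ B int[OF i] le[OF i], of n] q by auto
    show "expectation (avg n i) = 0" by (rule expectation_avg[OF i])
  qed (use q B in auto)
  \<comment> \<open>The lower bound on the squared \<open>proj_sd\<close>, which is 4 v / n, becomes
    linear growth of v.\<close>
  have ev: "\<forall>\<^sub>F n in sequentially. 2 \<le> n \<and> lam / 4 * real n \<le> v n"
    using lam(2) eventually_ge_at_top[of 2]
  proof eventually_elim
    case (elim n)
    then have "lam \<le> 4 / real n * v n" using v0 by (simp add: sd)
    then show ?case using elim by (simp add: field_simps)
  qed
  fix t :: real
  have CLT: "(\<lambda>n. expectation (\<lambda>\<omega>. iexp (t * P n \<omega>))) \<longlonglongrightarrow> complex_of_real (exp (- (t\<^sup>2) / 2))"
    unfolding P_def v_def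
    by (rule m_dependent_CLT[OF row, of "lam / 4"])
       (use lam(1) ev in \<open>auto simp: v_def elim: eventually_mono\<close>)
  have diff: "(\<lambda>n. expectation (\<lambda>\<omega>. iexp (t * G n \<omega>)) - expectation (\<lambda>\<omega>. iexp (t * P n \<omega>))) \<longlonglongrightarrow> 0"
  proof (rule tendsto_norm_zero_cancel, rule tendsto_sandwich[of "\<lambda>_. 0"])
    show "\<forall>\<^sub>F n in sequentially. norm (expectation (\<lambda>\<omega>. iexp (t * G n \<omega>)) - expectation (\<lambda>\<omega>. iexp (t * P n \<omega>)))
        \<le> \<bar>t\<bar> * (K / sqrt lam * inverse (sqrt (real n)))"
      using ev
    proof eventually_elim
      case (elim n)
      then have n: "2 \<le> n" and vn: "lam / 4 * real n \<le> v n" by auto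
      let ?R = "\<lambda>\<omega>. U_stat W \<phi> n \<omega> - 2 / real n * (\<Sum>i\<in>{1..n}. avg n i \<omega>)"
      define a where "a = inverse (proj_sd M S W \<phi> n m) * sqrt (real n)"
      note R = remainder_L1[OF n, folded K_def]
      have n0: "0 < real n" using n by simp
      have vp: "0 < v n" using vn lam(1) n0 by (smt (verit) divide_pos_pos mult_pos_pos)
      have sdn: "proj_sd M S W \<phi> n m = 2 * sqrt (v n) / sqrt n"
        unfolding sd by (simp add: real_sqrt_mult real_sqrt_divide)
      have a: "a = n / (2 * sqrt (v n))" 
        unfolding a_def sdn using n0 vp by (simp add: field_simps)
      \<comment> \<open>The factor 2 / n of the projection and the normalisation a = n / (2 sqrt v)
        multiply to 1 / sqrt v.\<close>
      have GP: "G n \<omega> - P n \<omega> = a * ?R \<omega>" for \<omega>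
      proof -
        have "P n \<omega> = a * (2 / real n * (\<Sum>i\<in>{1..n}. avg n i \<omega>))"
          unfolding a P_def using n0 vp by (simp add: field_simps)
        then show ?thesis by (simp add: G_def a_def right_diff_distrib)
      qed
      have a0: "0 \<le> a" using vp by (simp add: a)
      have sl: "sqrt lam * sqrt n \<le> 2 * sqrt (v n)"
      proof -
        have "sqrt (lam * n) \<le> sqrt (4 * v n)" using vn by (intro real_sqrt_le_mono) simp
        then show ?thesis by (simp add: real_sqrt_mult)
      qed
      have "cmod (expectation (\<lambda>\<omega>. iexp (t * G n \<omega>)) - expectation (\<lambda>\<omega>. iexp (t * P n \<omega>)))
          \<le> \<bar>t\<bar> * expectation (\<lambda>\<omega>. \<bar>G n \<omega> - P n \<omega>\<bar>)"
        by (rule expectation_iexp_diff_le[OF GM PM]) (unfold GP, use R(1) in simp)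
      also have "expectation (\<lambda>\<omega>. \<bar>G n \<omega> - P n \<omega>\<bar>) = a * expectation (\<lambda>\<omega>. \<bar>?R \<omega>\<bar>)"
        unfolding GP abs_mult using a0 by simp
      also have "\<dots> \<le> a * (K / n)" by (rule mult_left_mono[OF R(2) a0])
      also have "\<dots> = K / (2 * sqrt (v n))" using n0 by (simp add: a)
      also have "\<dots> \<le> K / (sqrt lam * sqrt n)"
        using sl lam(1) n0 B2_nonneg vp by (intro divide_left_mono mult_pos_pos) (auto simp: K_def)
      also have "\<dots> = K / sqrt lam * inverse (sqrt (real n))" by (simp add: divide_inverse)
      finally show ?case by (simp add: mult_left_mono)
    qed
    have "(\<lambda>n. inverse (sqrt (real n))) \<longlonglongrightarrow> 0"
      by (intro tendsto_inverse_0_at_top filterlim_compose[OF sqrt_at_top] filterlim_real_sequentially)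
    from tendsto_mult_left[OF tendsto_mult_left[OF this, of "K / sqrt lam"], of "\<bar>t\<bar>"]
    show "(\<lambda>n. \<bar>t\<bar> * (K / sqrt lam * inverse (sqrt (real n)))) \<longlonglongrightarrow> 0" by simp
  qed auto
  have "(\<lambda>n. expectation (\<lambda>\<omega>. iexp (t * G n \<omega>))) \<longlonglongrightarrow> complex_of_real (exp (- (t\<^sup>2) / 2))"
    using tendsto_add[OF diff CLT] by simp
  moreover have "char (distr M borel (G n)) t = expectation (\<lambda>\<omega>. iexp (t * G n \<omega>))" for n
    unfolding char_def by (subst integral_distr) auto
  ultimately have "(\<lambda>n. char (distr M borel (G n)) t) \<longlonglongrightarrow> complex_of_real (exp (- (t\<^sup>2) / 2))"
    by simp
  then show "(\<lambda>n. char (distr M borel (\<lambda>\<omega>. inverse (proj_sd M S W \<phi> n m) * sqrt (real n) * U_stat W \<phi> n \<omega>)) t)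
      \<longlonglongrightarrow> char std_normal_distribution t"
    unfolding G_def char_std_normal_distribution .
qed

end

theorem theorem2:
  fixes M :: "'a measure" and S :: "'b measure"
    and W :: "nat \<Rightarrow> 'a \<Rightarrow> 'b" and \<phi> :: "'b \<Rightarrow> 'b \<Rightarrow> real"
    and m :: nat and r :: real
  assumes "prob_space M"
    and "standard_borel S"
    and "m_dependent M S m W"
    and "(\<lambda>(x, y). \<phi> x y) \<in> borel_measurable (S \<Otimes>\<^sub>M S)"
    and "\<And>x y. x \<in> space S \<Longrightarrow> y \<in> space S \<Longrightarrow> \<phi> x y = \<phi> y x"
    and "lag_centred M m W \<phi>"
    and "r \<ge> 2"
    and "kernel_unif_integrable M W \<phi> r"
  shows
    "big_O_prob M
       (\<lambda>n \<omega>. U_stat W \<phi> n \<omega> - 2 / real n * (\<Sum>i\<in>{1..n}. avg_proj1 M S W \<phi> n m i \<omega>))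
       (\<lambda>n. (real m + 1) / real n)
     \<and> big_O_prob M (U_stat W \<phi>) (\<lambda>n. sqrt ((real m + 1) / real n))
     \<and> small_o_prob M (U_stat W \<phi>) (\<lambda>n. 1)
     \<and> (\<forall>r'>2. \<forall>lam>0.
          kernel_unif_integrable M W \<phi> r' \<longrightarrow>
          (\<forall>\<^sub>F n in sequentially. (proj_sd M S W \<phi> n m)\<^sup>2 \<ge> lam) \<longrightarrow>
          weak_conv_m
            (\<lambda>n. distr M borel (\<lambda>\<omega>. inverse (proj_sd M S W \<phi> n m) * sqrt (real n) * U_stat W \<phi> n \<omega>))
            std_normal_distribution)"
proof -
  interpret m_dependent_sequence M S W m
    using assms(1,3) by (simp add: m_dependent_sequence_def m_dependent_sequence_axioms_def)
  have phi_W: "(\<lambda>\<omega>. \<phi> (W i \<omega>) (W j \<omega>)) \<in> borel_measurable M" if "1 \<le> i" "1 \<le> j" for i j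
    using measurable_compose[OF measurable_Pair[OF W_measurable[OF that(1)] W_measurable[OF that(2)]] assms(4)] by simp
  obtain B where B: "0 \<le> B"
    "\<And>i j. 1 \<le> i \<Longrightarrow> 1 \<le> j \<Longrightarrow> integrable M (\<lambda>\<omega>. \<bar>\<phi> (W i \<omega>) (W j \<omega>)\<bar> powr r)"
    "\<And>i j. 1 \<le> i \<Longrightarrow> 1 \<le> j \<Longrightarrow> expectation (\<lambda>\<omega>. \<bar>\<phi> (W i \<omega>) (W j \<omega>)\<bar> powr r) \<le> B"
    by (rule kernel_moment_bound[OF W_measurable assms(4,8)]) (use assms(7) that in auto)
  \<comment> \<open>The moment of order r is lowered to order 2, which accounts for the added
    1.\<close>
  interpret m_dependent_kernel M S W m \<phi> "B + 1"
  proof unfold_locales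
    fix i j :: nat assume ij: "1 \<le> i" "1 \<le> j"
    note mom = powr_moment_mono[OF phi_W[OF ij] _ assms(7) B(2,3)[OF ij]]
    show "integrable M (\<lambda>\<omega>. (\<phi> (W i \<omega>) (W j \<omega>))\<^sup>2)"
      "expectation (\<lambda>\<omega>. (\<phi> (W i \<omega>) (W j \<omega>))\<^sup>2) \<le> B + 1"
      using mom by simp_all
  qed (use assms(4,5,6) in auto)
  define K where "K = 18 * real (2 * m + 1) * sqrt (B + 1)"
  define K' where "K' = K + 2 * sqrt (real (2 * m + 1) * (B + 1))"
  have K: "0 \<le> K" "0 \<le> K'" using B(1) by (auto simp: K_def K'_def)
  have pos: "\<forall>\<^sub>F n in sequentially. 0 < (real m + 1) / real n"
    using eventually_gt_at_top[of 0] by eventually_elim (simp add: add_nonneg_pos)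
  have "big_O_prob M (\<lambda>n \<omega>. U_stat W \<phi> n \<omega> - 2 / real n * (\<Sum>i\<in>{1..n}. avg n i \<omega>))
      (\<lambda>n. (real m + 1) / real n)"
  proof (rule big_O_prob_of_L1[OF _ K(1) pos])
    show "(\<lambda>\<omega>. U_stat W \<phi> n \<omega> - 2 / real n * (\<Sum>i\<in>{1..n}. avg n i \<omega>)) \<in> borel_measurable M" for n
      using U_stat_measurable[of n] avg_measurable[of _ n] by auto
    show "\<forall>\<^sub>F n in sequentially. integrable M (\<lambda>\<omega>. U_stat W \<phi> n \<omega> - 2 / real n * (\<Sum>i\<in>{1..n}. avg n i \<omega>)) \<and>
        expectation (\<lambda>\<omega>. \<bar>U_stat W \<phi> n \<omega> - 2 / real n * (\<Sum>i\<in>{1..n}. avg n i \<omega>)\<bar>) \<le> K * ((real m + 1) / real n)"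
      using eventually_ge_at_top[of 2]
    proof eventually_elim
      case (elim n)
      have "K / real n \<le> K * ((real m + 1) / real n)"
        using K by (simp add: divide_right_mono algebra_simps)
      then show ?case using remainder_L1[OF elim, folded K_def] by auto
    qed
  qed
  moreover
  have U1: "\<forall>\<^sub>F n in sequentially. integrable M (U_stat W \<phi> n) \<and>
      expectation (\<lambda>\<omega>. \<bar>U_stat W \<phi> n \<omega>\<bar>) \<le> K' * sqrt ((real m + 1) / real n)"
    using eventually_ge_at_top[of 2] unfolding K'_def K_def by eventually_elim (intro conjI U_stat_L1)
  have "big_O_prob M (U_stat W \<phi>) (\<lambda>n. sqrt ((real m + 1) / real n))"
    by (rule big_O_prob_of_L1[OF U_stat_measurable K(2) _ U1]) (use pos in simp)
  moreover have "small_o_prob M (U_stat W \<phi>) (\<lambda>n. 1)"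
  proof (rule small_o_prob_of_L1[OF U_stat_measurable U1])
    have "(\<lambda>n. (real m + 1) / real n) \<longlonglongrightarrow> 0" by (rule lim_const_over_n)
    from tendsto_mult_left[OF tendsto_real_sqrt[OF this], of K']
    show "(\<lambda>n. K' * sqrt ((real m + 1) / real n)) \<longlonglongrightarrow> 0" by simp
  qed
  moreover have "weak_conv_m
        (\<lambda>n. distr M borel (\<lambda>\<omega>. inverse (proj_sd M S W \<phi> n m) * sqrt (real n) * U_stat W \<phi> n \<omega>))
        std_normal_distribution"
    if r': "2 < r'" and lam: "0 < lam" and ui: "kernel_unif_integrable M W \<phi> r'"
      and ev: "\<forall>\<^sub>F n in sequentially. (proj_sd M S W \<phi> n m)\<^sup>2 \<ge> lam" for r' lam
  proof -
    obtain B' where B': "0 \<le> B'"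
      "\<And>i j. 1 \<le> i \<Longrightarrow> 1 \<le> j \<Longrightarrow> integrable M (\<lambda>\<omega>. \<bar>\<phi> (W i \<omega>) (W j \<omega>)\<bar> powr r')"
      "\<And>i j. 1 \<le> i \<Longrightarrow> 1 \<le> j \<Longrightarrow> expectation (\<lambda>\<omega>. \<bar>\<phi> (W i \<omega>) (W j \<omega>)\<bar> powr r') \<le> B'"
      by (rule kernel_moment_bound[OF W_measurable assms(4) ui]) (use r' that in auto)
    \<comment> \<open>The limit theorem wants an exponent of at most 3, so a larger r' is lowered to
      3, again at the cost of 1 in the bound.\<close>
    have q: "2 < min r' 3" "min r' 3 \<le> 3" "0 \<le> min r' 3" "min r' 3 \<le> r'" using r' by auto
    show ?thesis
      using powr_moment_mono[OF phi_W q(3,4) B'(2,3)] B'(1)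
      by (intro asymptotic_normality[OF q(1,2) _ _ _ lam ev, of "B' + 1"]) auto
  qed
  ultimately show ?thesis by blast
qed

end
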